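(* In the setting of the context, let $$f(p,\mathbf W_V,\mathbf W_L)=f_V(p,\mathbf W_V)+f_L(p,\mathbf W_L)+\Delta u,\qquad \Delta u=u_L-u_V,$$ where for $K\in\{V,L\}$ $$f_K(p,\mathbf W_K)=\begin{cases}\sqrt{-(p-p_K)(v_K(p)-v_K(p_K))},& p>p_K\ \text{(shock)},\\[4pt] \displaystyle\int_{p_K}^p\frac{v_K(\zeta)}{a_K(\zeta)}\,\mathrm d\zeta,& p\le p_K\ \text{(rarefaction)}.\end{cases}$$ If there is a root $f(p^\ast,\mathbf W_V,\mathbf W_L)=0$ with $0<p^\ast\le\tilde p$, then this root is unique. Further, $p^\ast$ is the unique solution for the pressure $p_V^\ast$ ($=p_L^\ast$) of the two-phase Riemann problem without phase transition. The velocity $u^\ast:=u_V^\ast=u_L^\ast$ is given by $$u^\ast=\tfrac12(u_L+u_V)+\tfrac12\bigl(f_L(p^\ast,\mathbf W_L)-f_V(p^\ast,\mathbf W_V)\bigr).$$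
   Context: Thermodynamics. Two phases (vapor $V$, liquid $L$) of one substance at a fixed temperature. For $K\in\{V,L\}$, $v_K(p)>0$ is the specific volume as a (at least $C^2$) function of the pressure $p$, with $p\in(0,\infty)$ for $K=V$ and $p\in[p_{min},\infty)$ for $K=L$, where $p_{min}\le 0$ is the minimum liquid pressure; $\rho=1/v$ is the density. The sound speed $a_K(p)>0$ is defined by $v_K'=-v_K^2/a_K^2$; the Gibbs energy satisfies $g_K'=v_K$; the saturation pressure $p_0>0$ satisfies $g_L(p_0)=g_V(p_0)$. $\gamma_K=\frac{a_K^2}{p v_K}$, $\mathcal G_K=1+\frac{a_K}{v_K}a_K'$, and $\mathcal G_K>0$ is assumed. $v_K(p)\to0$ as $p\to\infty$, and $v_V(p)\to\infty$ as $p\to0^+$. $\tau>0$ is a constant. There are constants $\alpha\in(0,1)$, $\beta>0$ such that, with $\sigma_{max}=\frac{1+\sqrt{11-6\alpha}}2$, uniformly for $p_V\in(0,\sigma_{max}p_0]$, $p_L\in[p_{min},\infty)$: $0<\frac{v_L(p_L)}{v_V(p_V)}\le\alpha$, $0<\frac{v_L(p_L)a_V(p_V)}{v_V(p_V)a_L(p_L)}\le\alpha\beta<1$, $\tau(1-\alpha)^2a_V(p_V)^3<\gamma_V(p_V)$. With $\varepsilon(\gamma_V)=\frac1{\gamma_V}-1-\frac{\tau a_V^3}{\gamma_V^2}(1-\alpha)^2(1-(\alpha\beta)^2)$, one of the following holds (for these $p_V$ and all $p_L>0$): (I) $\gamma_V\le1\le\gamma_L$ and $\frac1{\gamma_L}\ge1+\frac{\varepsilon(\gamma_V)}\alpha$;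 or (II) $\gamma_V<1$, $\gamma_L<1$, $\alpha\le\frac{1-1/\gamma_V}{1-1/\gamma_L}$ and $\varepsilon(\gamma_V)\le0$. Maximum vapor pressure $\tilde p$ (assumed $\le\sigma_{max}p_0$): let $\bar v$ be a function with $\bar v'>0$, $\bar v(p_{min})=v_L(p_{min})$, $\bar v(\tilde p)=v_V(\tilde p)$, and inverse $\bar p$; let $p(v)$ be the inverse of $v_L$ for $v\le v_L(p_{min})$, $\bar p(v)$ for $v_L(p_{min})<v<v_V(\tilde p)$, and the inverse of $v_V$ for $v\ge v_V(\tilde p)$. Then $\tilde p$ solves $0=p_0(v_V(p_0)-v_L(p_0))-\int_{v_L(p_0)}^{v_V(p_0)}p(v)\,\mathrm dv$. Riemann problem. Isothermal Euler equations $\partial_t\rho+\partial_x(\rho u)=0$, $\partial_t(\rho u)+\partial_x(\rho u^2+p)=0$, with initial data: vapor state $\mathbf W_V=(\rho_V,u_V)$, of pressure $p_V\in(0,\tilde p]$, for $x<0$, and liquid state $\mathbf W_L=(\rho_L,u_L)$, of pressure $p_L\ge p_{min}$, for $x>0$. Across a discontinuity of speed $W$, with $[\![\Psi]\!]=\Psi^+-\Psi^-$ (right minus left) and $Z=-\rho(u-W)$: $[\![Z]\!]=0$, $-Z[\![u]\!]+[\![p]\!]=0$, and $Z[\![g+\tfrac12u^2]\!]\ge0$. A solution is self-similar and consists of four constant states separated by two classical waves (shocks or rarefaction waves inside one phase) and one phase boundary, with vapor pressures in $(0,\tilde p]$; $(\rho_V^\ast,u_V^\ast)$ with pressure $p_V^\ast$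 and $(\rho_L^\ast,u_L^\ast)$ with pressure $p_L^\ast$ are the vapor and liquid states adjacent to the phase boundary. ``Without phase transition'' means that the mass flux across the phase boundary is $z=0$ (so $p$ and $u$ are continuous across it).
   Formalization: The entropy inequality is taken with the velocity relative to the discontinuity, Z[[g + (u−W)²/2]] ≥ 0, instead of Z[[g + u²/2]] ≥ 0; with the printed u, adding a large negative constant to both velocities rules out compressive vapor shocks and existence fails. *)

theory Defs
  imports "HOL-Analysis.Analysis"
begin

section \<open>Thermodynamics of the two phases\<close>

datatype phase = Vapor | Liquid

fun pressure_dom :: "real \<Rightarrow> phase \<Rightarrow> real set" where
  "pressure_dom pmin Vapor = {0<..}"
| "pressure_dom pmin Liquid = {pmin..}"

definition gamma_coeff :: "(phase \<Rightarrow> real \<Rightarrow> real) \<Rightarrow> (phase \<Rightarrow> real \<Rightarrow> real) \<Rightarrow> phase \<Rightarrow> real \<Rightarrow> real"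
  where "gamma_coeff v a K p = (a K p)\<^sup>2 / (p * v K p)"

text \<open>\<^term>\<open>\<G> = 1 + (a / v) * a'\<close>; the derivative is one-sided at the end point of the liquid range.\<close>

definition fundamental_deriv ::
  "(phase \<Rightarrow> real \<Rightarrow> real) \<Rightarrow> (phase \<Rightarrow> real \<Rightarrow> real) \<Rightarrow> real \<Rightarrow> phase \<Rightarrow> real \<Rightarrow> real"
  where "fundamental_deriv v a pmin K p =
    1 + a K p / v K p * vector_derivative (a K) (at p within pressure_dom pmin K)"

text \<open>The sound speed is given implicitly, by its positivity and \<^term>\<open>v' = - v\<^sup>2 / a\<^sup>2\<close>.\<close>

locale two_phase_substance =
  fixes v a g :: "phase \<Rightarrow> real \<Rightarrow> real" and pmin p0 :: real
  assumes pmin_nonpos: "pmin \<le> 0"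
    and v_pos: "p \<in> pressure_dom pmin K \<Longrightarrow> v K p > 0"
    and v_C2: "\<exists>v' v''. continuous_on (pressure_dom pmin K) v'' \<and>
      (\<forall>p\<in>pressure_dom pmin K.
        (v K has_real_derivative v' p) (at p within pressure_dom pmin K) \<and>
        (v' has_real_derivative v'' p) (at p within pressure_dom pmin K))"
    and a_pos: "p \<in> pressure_dom pmin K \<Longrightarrow> a K p > 0"
    and sound_speed: "p \<in> pressure_dom pmin K \<Longrightarrow>
      (v K has_real_derivative - (v K p)\<^sup>2 / (a K p)\<^sup>2) (at p within pressure_dom pmin K)"
    and gibbs: "p \<in> pressure_dom pmin K \<Longrightarrow>
      (g K has_real_derivative v K p) (at p within pressure_dom pmin K)"
    and p0_pos: "p0 > 0"
    and saturation: "g Liquid p0 = g Vapor p0"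
    and fundamental_deriv_pos: "p \<in> pressure_dom pmin K \<Longrightarrow> fundamental_deriv v a pmin K p > 0"
    and v_at_top: "(v K \<longlongrightarrow> 0) at_top"
    and v_vapor_at_0: "filterlim (v Vapor) at_top (at_right 0)"

definition sigma_max :: "real \<Rightarrow> real"
  where "sigma_max \<alpha> = (1 + sqrt (11 - 6 * \<alpha>)) / 2"

definition epsilon_V :: "(phase \<Rightarrow> real \<Rightarrow> real) \<Rightarrow> (phase \<Rightarrow> real \<Rightarrow> real) \<Rightarrow>
    real \<Rightarrow> real \<Rightarrow> real \<Rightarrow> real \<Rightarrow> real"
  where "epsilon_V v a \<tau> \<alpha> \<beta> p =
    1 / gamma_coeff v a Vapor p - 1
    - \<tau> * (a Vapor p) ^ 3 / (gamma_coeff v a Vapor p)\<^sup>2 * (1 - \<alpha>)\<^sup>2 * (1 - (\<alpha> * \<beta>)\<^sup>2)"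

locale two_phase_setting = two_phase_substance +
  fixes \<tau> \<alpha> \<beta> :: real
  assumes tau_pos: "\<tau> > 0"
    and alpha: "0 < \<alpha>" "\<alpha> < 1"
    and beta_pos: "\<beta> > 0"
    and alpha_beta: "\<alpha> * \<beta> < 1"
    and volume_ratio:
      "\<lbrakk>0 < pV; pV \<le> sigma_max \<alpha> * p0; pmin \<le> pL\<rbrakk> \<Longrightarrow>
        0 < v Liquid pL / v Vapor pV \<and> v Liquid pL / v Vapor pV \<le> \<alpha>"
    and impedance_ratio:
      "\<lbrakk>0 < pV; pV \<le> sigma_max \<alpha> * p0; pmin \<le> pL\<rbrakk> \<Longrightarrow>
        0 < (v Liquid pL * a Vapor pV) / (v Vapor pV * a Liquid pL) \<and>
        (v Liquid pL * a Vapor pV) / (v Vapor pV * a Liquid pL) \<le> \<alpha> * \<beta>"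
    and tau_bound:
      "\<lbrakk>0 < pV; pV \<le> sigma_max \<alpha> * p0\<rbrakk> \<Longrightarrow>
        \<tau> * (1 - \<alpha>)\<^sup>2 * (a Vapor pV) ^ 3 < gamma_coeff v a Vapor pV"
    and gamma_cases:
      "(\<forall>pV pL. 0 < pV \<and> pV \<le> sigma_max \<alpha> * p0 \<and> 0 < pL \<longrightarrow>
          gamma_coeff v a Vapor pV \<le> 1 \<and> 1 \<le> gamma_coeff v a Liquid pL \<and>
          1 / gamma_coeff v a Liquid pL \<ge> 1 + epsilon_V v a \<tau> \<alpha> \<beta> pV / \<alpha>)
       \<or>
       (\<forall>pV pL. 0 < pV \<and> pV \<le> sigma_max \<alpha> * p0 \<and> 0 < pL \<longrightarrow>
          gamma_coeff v a Vapor pV < 1 \<and> gamma_coeff v a Liquid pL < 1 \<and>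
          \<alpha> \<le> (1 - 1 / gamma_coeff v a Vapor pV) / (1 - 1 / gamma_coeff v a Liquid pL) \<and>
          epsilon_V v a \<tau> \<alpha> \<beta> pV \<le> 0)"


section \<open>Maximum vapor pressure\<close>

definition extended_pressure ::
  "(phase \<Rightarrow> real \<Rightarrow> real) \<Rightarrow> real \<Rightarrow> (real \<Rightarrow> real) \<Rightarrow> real \<Rightarrow> real \<Rightarrow> real"
  where "extended_pressure v pmin vbar pt x =
    (if x \<le> v Liquid pmin then the_inv_into {pmin..} (v Liquid) x
     else if x < v Vapor pt then the_inv_into {pmin..pt} vbar x
     else the_inv_into {0<..} (v Vapor) x)"

definition max_vapor_pressure ::
  "(phase \<Rightarrow> real \<Rightarrow> real) \<Rightarrow> real \<Rightarrow> real \<Rightarrow> (real \<Rightarrow> real) \<Rightarrow> real \<Rightarrow> bool"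
  where "max_vapor_pressure v pmin p0 vbar pt \<longleftrightarrow>
    pt > 0 \<and>
    (\<forall>p\<in>{pmin..pt}. \<exists>d>0. (vbar has_real_derivative d) (at p within {pmin..pt})) \<and>
    vbar pmin = v Liquid pmin \<and> vbar pt = v Vapor pt \<and>
    0 = p0 * (v Vapor p0 - v Liquid p0)
        - integral {v Liquid p0 .. v Vapor p0} (extended_pressure v pmin vbar pt)"


section \<open>The two-phase Riemann problem\<close>

text \<open>
  A state \<open>(\<rho>, u)\<close> of phase \<open>K\<close> is encoded as the pair \<open>(p, u)\<close> of its pressure and velocity, with
  \<open>\<rho> = 1 / v K p\<close>. This loses nothing, because \<open>v K\<close> is strictly decreasing.
\<close>

type_synonym state = "real \<times> real"

definition density :: "(phase \<Rightarrow> real \<Rightarrow> real) \<Rightarrow> phase \<Rightarrow> real \<Rightarrow> real"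
  where "density v K p = 1 / v K p"

definition mass_flux :: "(phase \<Rightarrow> real \<Rightarrow> real) \<Rightarrow> real \<Rightarrow> phase \<Rightarrow> state \<Rightarrow> real"
  where "mass_flux v W K s = - density v K (fst s) * (snd s - W)"

text \<open>
  Jump conditions between the left state \<open>s\<close> (phase \<open>K\<close>) and the right state \<open>s'\<close> (phase \<open>K'\<close>) across
  a discontinuity of speed \<open>W\<close>. In the entropy inequality \<open>Z [g + u^2/2] \<ge> 0\<close> the kinetic energy is
  the one in the rest frame of the discontinuity, so \<open>u - W\<close> occurs. With the velocity of a
  fixed frame instead, the left-hand side would change by \<open>W [p]\<close>, the condition would not be
  Galilean invariant, and it would exclude compressive shocks or admit expansive ones, depending
  on the frame.
\<close>

definition jump_conditions ::
  "(phase \<Rightarrow> real \<Rightarrow> real) \<Rightarrow> (phase \<Rightarrow> real \<Rightarrow> real) \<Rightarrow> real \<Rightarrow>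
   phase \<Rightarrow> state \<Rightarrow> phase \<Rightarrow> state \<Rightarrow> bool"
  where "jump_conditions v g W K s K' s' \<longleftrightarrow>
    mass_flux v W K' s' - mass_flux v W K s = 0 \<and>
    - mass_flux v W K s * (snd s' - snd s) + (fst s' - fst s) = 0 \<and>
    mass_flux v W K s *
      ((g K' (fst s') + (snd s' - W)\<^sup>2 / 2) - (g K (fst s) + (snd s - W)\<^sup>2 / 2)) \<ge> 0"

definition isothermal_euler_at ::
  "(real \<Rightarrow> real \<Rightarrow> real) \<Rightarrow> (real \<Rightarrow> real \<Rightarrow> real) \<Rightarrow> (real \<Rightarrow> real \<Rightarrow> real) \<Rightarrow> real \<Rightarrow> real \<Rightarrow> bool"
  where "isothermal_euler_at \<rho> u p t x \<longleftrightarrow>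
    (\<exists>\<rho>\<^sub>t q\<^sub>x q\<^sub>t F\<^sub>x.
      ((\<lambda>s. \<rho> s x) has_real_derivative \<rho>\<^sub>t) (at t) \<and>
      ((\<lambda>y. \<rho> t y * u t y) has_real_derivative q\<^sub>x) (at x) \<and>
      ((\<lambda>s. \<rho> s x * u s x) has_real_derivative q\<^sub>t) (at t) \<and>
      ((\<lambda>y. \<rho> t y * (u t y)\<^sup>2 + p t y) has_real_derivative F\<^sub>x) (at x) \<and>
      \<rho>\<^sub>t + q\<^sub>x = 0 \<and> q\<^sub>t + F\<^sub>x = 0)"

fun admissible_pressures :: "real \<Rightarrow> real \<Rightarrow> phase \<Rightarrow> real set" where
  "admissible_pressures pmin pt Vapor = {0<..pt}"
| "admissible_pressures pmin pt Liquid = {pmin..}"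

text \<open>
  \<open>P\<close> and \<open>U\<close> are the profiles of pressure and velocity as functions of \<open>x / t\<close>. A rarefaction wave
  fills the sector \<open>l \<le> x / t \<le> r\<close>: it is a continuous, in the interior differentiable, solution of the
  Euler equations whose profile has no stationary point, i.e. contains no constant piece.
\<close>

definition rarefaction_wave ::
  "(phase \<Rightarrow> real \<Rightarrow> real) \<Rightarrow> real \<Rightarrow> real \<Rightarrow> phase \<Rightarrow> (real \<Rightarrow> real) \<Rightarrow> (real \<Rightarrow> real) \<Rightarrow>
   real \<Rightarrow> real \<Rightarrow> state \<Rightarrow> state \<Rightarrow> bool"
  where "rarefaction_wave v pmin pt K P U l r s s' \<longleftrightarrow>
    l < r \<and> continuous_on {l..r} P \<and> continuous_on {l..r} U \<and>
    (P l, U l) = s \<and> (P r, U r) = s' \<and>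
    (\<forall>\<xi>\<in>{l..r}. P \<xi> \<in> admissible_pressures pmin pt K) \<and>
    (\<forall>\<xi>\<in>{l<..<r}. \<exists>P' U'. (P has_real_derivative P') (at \<xi>) \<and>
        (U has_real_derivative U') (at \<xi>) \<and> (P' \<noteq> 0 \<or> U' \<noteq> 0)) \<and>
    (\<forall>t x. t > 0 \<and> l < x / t \<and> x / t < r \<longrightarrow>
        isothermal_euler_at (\<lambda>t x. density v K (P (x / t))) (\<lambda>t x. U (x / t)) (\<lambda>t x. P (x / t)) t x)"

text \<open>A shock may have zero strength: this is how an absent wave is represented.\<close>

definition classical_wave ::
  "(phase \<Rightarrow> real \<Rightarrow> real) \<Rightarrow> (phase \<Rightarrow> real \<Rightarrow> real) \<Rightarrow> real \<Rightarrow> real \<Rightarrow> phase \<Rightarrow>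
   (real \<Rightarrow> real) \<Rightarrow> (real \<Rightarrow> real) \<Rightarrow> real \<Rightarrow> real \<Rightarrow> state \<Rightarrow> state \<Rightarrow> bool"
  where "classical_wave v g pmin pt K P U l r s s' \<longleftrightarrow>
    (l = r \<and> jump_conditions v g l K s K s') \<or> rarefaction_wave v pmin pt K P U l r s s'"

text \<open>
  The constant states are \<open>S 0, \<dots>, S 3\<close> from left to right; wave \<open>i\<close> (with \<open>1 \<le> i \<le> 3\<close>) occupies
  \<open>l i \<le> x / t \<le> r i\<close> and separates \<open>S (i - 1)\<close> from \<open>S i\<close>. Wave \<open>j\<close> is the phase boundary, so the
  states \<open>S i\<close> with \<open>i < j\<close> are vapor and the others liquid; the position of the phase boundary
  among the waves is not prescribed. The vapor and liquid states adjacent to the phase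
  boundary are \<open>S (j - 1)\<close> and \<open>S j\<close>. The values of \<open>S 0\<close> and \<open>S 3\<close> express the initial condition,
  as \<open>x / t\<close> tends to minus or plus infinity for \<open>t\<close> tending to 0 from the right.
\<close>

definition phase_of :: "nat \<Rightarrow> nat \<Rightarrow> phase"
  where "phase_of j i = (if i < j then Vapor else Liquid)"

definition riemann_solution ::
  "(phase \<Rightarrow> real \<Rightarrow> real) \<Rightarrow> (phase \<Rightarrow> real \<Rightarrow> real) \<Rightarrow> real \<Rightarrow> real \<Rightarrow> state \<Rightarrow> state \<Rightarrow>
   nat \<Rightarrow> (nat \<Rightarrow> real) \<Rightarrow> (nat \<Rightarrow> real) \<Rightarrow> (nat \<Rightarrow> state) \<Rightarrow> (real \<Rightarrow> real) \<Rightarrow> (real \<Rightarrow> real) \<Rightarrow> bool"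
  where "riemann_solution v g pmin pt WV WL j l r S P U \<longleftrightarrow>
    j \<in> {1, 2, 3} \<and>
    (\<forall>i\<in>{1, 2, 3}. l i \<le> r i) \<and> r 1 < l 2 \<and> r 2 < l 3 \<and>
    S 0 = WV \<and> S 3 = WL \<and>
    (\<forall>i\<in>{0, 1, 2, 3}. fst (S i) \<in> admissible_pressures pmin pt (phase_of j i)) \<and>
    (\<forall>\<xi>. \<xi> < l 1 \<longrightarrow> (P \<xi>, U \<xi>) = S 0) \<and>
    (\<forall>i\<in>{1, 2}. \<forall>\<xi>. r i < \<xi> \<and> \<xi> < l (i + 1) \<longrightarrow> (P \<xi>, U \<xi>) = S i) \<and>
    (\<forall>\<xi>. r 3 < \<xi> \<longrightarrow> (P \<xi>, U \<xi>) = S 3) \<and>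
    (\<forall>i\<in>{1, 2, 3} - {j}.
        classical_wave v g pmin pt (phase_of j i) P U (l i) (r i) (S (i - 1)) (S i)) \<and>
    l j = r j \<and> jump_conditions v g (l j) Vapor (S (j - 1)) Liquid (S j)"

text \<open>
  \<open>WV'\<close> and \<open>WL'\<close> are the vapor and liquid states adjacent to the phase boundary of some solution
  for which the mass flux across the phase boundary vanishes.
\<close>

definition solution_without_phase_transition ::
  "(phase \<Rightarrow> real \<Rightarrow> real) \<Rightarrow> (phase \<Rightarrow> real \<Rightarrow> real) \<Rightarrow> real \<Rightarrow> real \<Rightarrow> state \<Rightarrow> state \<Rightarrow>
   state \<Rightarrow> state \<Rightarrow> bool"
  where "solution_without_phase_transition v g pmin pt WV WL WV' WL' \<longleftrightarrow>
    (\<exists>j l r S P U. riemann_solution v g pmin pt WV WL j l r S P U \<and>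
       S (j - 1) = WV' \<and> S j = WL' \<and> mass_flux v (l j) Vapor (S (j - 1)) = 0)"


section \<open>The function f\<close>

text \<open>In the rarefaction case the integral from \<open>fst W\<close> to \<open>p\<close> runs backwards, whence the sign.\<close>

definition wave_fun ::
  "(phase \<Rightarrow> real \<Rightarrow> real) \<Rightarrow> (phase \<Rightarrow> real \<Rightarrow> real) \<Rightarrow> phase \<Rightarrow> real \<Rightarrow> state \<Rightarrow> real"
  where "wave_fun v a K p W =
    (if p > fst W then sqrt (- (p - fst W) * (v K p - v K (fst W)))
     else - integral {p..fst W} (\<lambda>\<zeta>. v K \<zeta> / a K \<zeta>))"

definition riemann_fun ::
  "(phase \<Rightarrow> real \<Rightarrow> real) \<Rightarrow> (phase \<Rightarrow> real \<Rightarrow> real) \<Rightarrow> real \<Rightarrow> state \<Rightarrow> state \<Rightarrow> real"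
  where "riemann_fun v a p WV WL =
    wave_fun v a Vapor p WV + wave_fun v a Liquid p WL + (snd WL - snd WV)"

end

theory Submission
  imports Defs
begin

text \<open>
  Positivity of \<open>\<G>\<close> makes \<open>v / a\<close> strictly decreasing, hence \<open>v\<close> strictly convex. By convexity the
  entropy inequality (a comparison of \<open>\<integral> v dp\<close> with the trapezoidal rule) admits exactly the
  compressive shocks, and these satisfy the Lax conditions; on a rarefaction fan
  \<open>\<xi> = u \<mp> a\<close> holds with a constant sign and \<open>u \<plusminus> \<integral> v / a dp\<close> is constant. So the velocity behind a
  left-facing wave is \<open>u\<^sub>V - f\<^sub>V\<close>, and behind a right-facing one \<open>u\<^sub>L + f\<^sub>L\<close>. A phase boundary without
  mass flux moves with the fluid, so only left-facing waves lie to its left and right-facing ones to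
  its right, and equality of the two velocities is the equation \<open>f = 0\<close>. It has at most one root since
  \<open>f\<^sub>V\<close> and \<open>f\<^sub>L\<close> are strictly increasing in the pressure.
\<close>

section \<open>Calculus: composition with one-sided derivatives, inverse functions\<close>

text \<open>At the lower end of the liquid range the thermodynamic functions are differentiable from
  one side only. Composed with a profile they still have a two-sided derivative, because the profile
  maps a whole neighbourhood into their domain.\<close>

lemma DERIV_chain_open:
  fixes f P :: "real \<Rightarrow> real"
  assumes f: "(f has_real_derivative D) (at (P \<xi>) within T)"
    and P: "(P has_real_derivative P') (at \<xi>)" and X: "open X" "\<xi> \<in> X" "P ` X \<subseteq> T"
  shows "((\<lambda>\<xi>. f (P \<xi>)) has_real_derivative D * P') (at \<xi>)"
proof -
  have "(f \<circ> P has_real_derivative D * P') (at \<xi> within X)"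
    using DERIV_image_chain[OF has_field_derivative_subset[OF f X(3)]] P
    by (auto intro: has_field_derivative_at_within)
  then show ?thesis
    using at_within_open[OF X(2,1)] by (simp add: o_def)
qed

text \<open>For building a rarefaction fan, whose pressure profile is the inverse of \<xi> as a
  function of the pressure. Derivatives enter only in the interior, since a fan need not be
  differentiable at its edges.\<close>

lemma increasing_inverse:
  fixes H H' :: "real \<Rightarrow> real"
  assumes qp: "q < p" and cont: "continuous_on {q..p} H"
    and der: "\<And>x. q < x \<Longrightarrow> x < p \<Longrightarrow> (H has_real_derivative H' x) (at x)"
    and pos: "\<And>x. q < x \<Longrightarrow> x < p \<Longrightarrow> H' x > 0"
  obtains G where "H q < H p" "continuous_on {H q..H p} G" "G (H q) = q" "G (H p) = p"
    "\<And>y. y \<in> {H q..H p} \<Longrightarrow> G y \<in> {q..p} \<and> H (G y) = y"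
    "\<And>y. y \<in> {H q<..<H p} \<Longrightarrow> G y \<in> {q<..<p}"
    "\<And>y. y \<in> {H q<..<H p} \<Longrightarrow> (G has_real_derivative inverse (H' (G y))) (at y)"
proof -
  have mono: "H x < H y" if "q \<le> x" "x < y" "y \<le> p" for x y
  proof (rule DERIV_pos_imp_increasing_open[OF \<open>x < y\<close>])
    show "\<exists>d. (H has_real_derivative d) (at z) \<and> d > 0" if "x < z" "z < y" for z
      using der[of z] pos[of z] that \<open>q \<le> x\<close> \<open>y \<le> p\<close> by auto
  qed (rule continuous_on_subset[OF cont], use that in auto)
  have inj: "inj_on H {q..p}"
    by (rule linorder_inj_onI) (auto dest: mono)
  have img: "H ` {q..p} = {H q..H p}"
  proof
    show "H ` {q..p} \<subseteq> {H q..H p}"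
    proof (rule image_subsetI)
      fix x assume "x \<in> {q..p}"
      then show "H x \<in> {H q..H p}" using mono[of q x] mono[of x p] by (cases "x = q"; cases "x = p") auto
    qed
    show "{H q..H p} \<subseteq> H ` {q..p}"
      using IVT'[of H q _ p] cont qp by (auto simp: image_iff) (metis atLeastAtMost_iff)
  qed
  define G where "G = the_inv_into {q..p} H"
  have GH: "G (H x) = x" if "x \<in> {q..p}" for x
    unfolding G_def by (rule the_inv_into_f_f[OF inj that])
  have HG: "G y \<in> {q..p} \<and> H (G y) = y" if "y \<in> {H q..H p}" for y
    using that GH unfolding img[symmetric] by auto
  have Hqp: "H q < H p" using mono qp by auto
  have contG: "continuous_on {H q..H p} G"
    using continuous_on_inv[OF cont] GH img by auto
  have G_int: "G y \<in> {q<..<p}" if y: "y \<in> {H q<..<H p}" for y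
  proof -
    have "G y \<in> {q..p}" "H (G y) = y" using HG[of y] y by auto
    moreover from this y have "G y \<noteq> q" "G y \<noteq> p" by auto
    ultimately show ?thesis by auto
  qed
  have "(G has_real_derivative inverse (H' (G y))) (at y)" if y: "y \<in> {H q<..<H p}" for y
  proof (rule DERIV_inverse_function)
    have "G y \<in> {q<..<p}" by (rule G_int[OF y])
    then show "(H has_real_derivative H' (G y)) (at (G y))" "H' (G y) \<noteq> 0"
      using der pos by force+
    show "H q < y" "y < H p" using y by auto
    show "H (G z) = z" if "H q < z" "z < H p" for z using HG that by simp
    show "isCont G y"
      using continuous_on_interior[OF contG] y by simp
  qed
  with that[of G] Hqp contG HG G_int show thesis
    using GH[of q] GH[of p] qp by auto
qed

context two_phase_substance
begin

section \<open>Convexity of the specific volume\<close>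

abbreviation pdom :: "phase \<Rightarrow> real set"
  where "pdom \<equiv> pressure_dom pmin"

lemma dom_upward: "p \<in> pdom K \<Longrightarrow> p \<le> q \<Longrightarrow> q \<in> pdom K"
  by (cases K) auto

lemma atLeastAtMost_subset_dom: "p \<in> pdom K \<Longrightarrow> {p..q} \<subseteq> pdom K"
  using dom_upward by auto

lemma at_within_dom: "p \<in> pdom K \<Longrightarrow> p < q \<Longrightarrow> at q within pdom K = at q"
  by (rule at_within_open_subset[where S = "{p<..}"]) (auto intro: dom_upward)

text \<open>Makes derivatives within the domain unique, also at \<open>pmin\<close>: the domain
  contains a right neighbourhood of each of its points.\<close>

lemma at_within_dom_neq_bot:
  assumes "p \<in> pdom K" shows "at p within pdom K \<noteq> bot"
proof
  assume "at p within pdom K = bot"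
  moreover have "at_right p \<le> at p within pdom K"
    using assms by (intro at_le) (auto intro: dom_upward)
  ultimately show False
    using trivial_limit_at_right_real[of p] by (simp add: bot_unique)
qed

text \<open>Since \<open>a = v / sqrt (- v')\<close> and \<open>v'\<close> is differentiable, so is
  \<open>a\<close>; only then is the \<open>vector_derivative\<close> in
  \<open>fundamental_deriv\<close> a true derivative. The factorization
  \<open>\<G> = (a / v) * (v / a + a')\<close> turns positivity of \<G> into the inequality used
  from here on.\<close>

lemma sound_speed_derivative:
  assumes p: "p \<in> pdom K"
  obtains d where "(a K has_real_derivative d) (at p within pdom K)" "v K p / a K p + d > 0"
proof -
  obtain v' v'' where
    v': "\<And>p. p \<in> pdom K \<Longrightarrow> (v K has_real_derivative v' p) (at p within pdom K)" and
    v'': "\<And>p. p \<in> pdom K \<Longrightarrow> (v' has_real_derivative v'' p) (at p within pdom K)"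
    using v_C2[of K] by blast
  have v'_eq: "v' q = - (v K q)\<^sup>2 / (a K q)\<^sup>2" if "q \<in> pdom K" for q
    by (rule has_field_derivative_unique[OF v' sound_speed at_within_dom_neq_bot])
       (use that in auto)
  have a_eq: "a K q = v K q / sqrt (- v' q)" if "q \<in> pdom K" for q
    using v_pos[OF that] a_pos[OF that]
    by (simp add: v'_eq[OF that] real_sqrt_divide)
  have neg: "- v' p > 0"
    using v_pos[OF p] a_pos[OF p] by (simp add: v'_eq[OF p])
  have "\<exists>d. ((\<lambda>q. v K q / sqrt (- v' q)) has_real_derivative d) (at p within pdom K)"
    using neg by (auto intro!: exI derivative_eq_intros v' v'' p)
  then obtain d where d: "((\<lambda>q. v K q / sqrt (- v' q)) has_real_derivative d) (at p within pdom K)"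
    by blast
  have d': "(a K has_real_derivative d) (at p within pdom K)"
    by (rule has_field_derivative_transform_within[OF d zero_less_one p]) (use a_eq in auto)
  have "vector_derivative (a K) (at p within pdom K) = d"
    using d' at_within_dom_neq_bot[OF p]
    by (intro vector_derivative_within) (auto simp: has_real_derivative_iff_has_vector_derivative)
  with fundamental_deriv_pos[OF p] have "1 + a K p / v K p * d > 0"
    by (simp add: fundamental_deriv_def)
  then have "v K p / a K p * (1 + a K p / v K p * d) > 0"
    using v_pos[OF p] a_pos[OF p] by simp
  also have "v K p / a K p * (1 + a K p / v K p * d) = v K p / a K p + d"
    using v_pos[OF p] a_pos[OF p] by (simp add: distrib_left)
  finally have "v K p / a K p + d > 0" .
  with d' show ?thesis by (rule that)
qed

lemma continuous_on_sound_speed: "continuous_on (pdom K) (a K)"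
  by (metis DERIV_continuous continuous_on_eq_continuous_within sound_speed_derivative)

lemma continuous_on_volume: "continuous_on (pdom K) (v K)"
  using sound_speed by (metis DERIV_continuous continuous_on_eq_continuous_within)

lemma continuous_on_impedance: "continuous_on (pdom K) (\<lambda>p. v K p / a K p)"
  using a_pos by (intro continuous_intros continuous_on_sound_speed continuous_on_volume)
    (metis less_irrefl)

text \<open>The derivative of \<open>v / a\<close> is
  \<open>- (v / a\<^sup>2) * (v / a + a')\<close>, whose last factor is positive because \<G>
  is.\<close>

lemma impedance_decreasing:
  assumes p: "p \<in> pdom K" and "p < q"
  shows "v K q / a K q < v K p / a K p"
proof (rule DERIV_neg_imp_decreasing_open[OF \<open>p < q\<close>])
  fix x assume "p < x" "x < q"
  then have x: "x \<in> pdom K" and at: "at x within pdom K = at x"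
    using p dom_upward at_within_dom by auto
  obtain d where d: "(a K has_real_derivative d) (at x within pdom K)" "v K x / a K x + d > 0"
    by (rule sound_speed_derivative[OF x])
  have pos: "v K x > 0" "a K x > 0"
    using v_pos[OF x] a_pos[OF x] .
  have "((\<lambda>p. v K p / a K p) has_real_derivative
      (- (v K x)\<^sup>2 / (a K x)\<^sup>2 * a K x - v K x * d) / (a K x * a K x)) (at x)"
    using DERIV_divide[OF sound_speed[OF x] d(1)] pos by (simp add: at)
  moreover have "- (v K x)\<^sup>2 / (a K x)\<^sup>2 * a K x - v K x * d = - v K x * (v K x / a K x + d)"
    using pos by (simp add: field_simps power2_eq_square)
  ultimately show "\<exists>y. ((\<lambda>p. v K p / a K p) has_real_derivative y) (at x) \<and> y < 0"
    using pos d(2) by (intro exI[of _ "- v K x * (v K x / a K x + d) / (a K x * a K x)"])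
      (auto intro!: divide_neg_pos mult_neg_pos simp: minus_mult_left[symmetric] simp del: minus_mult_left)
next
  show "continuous_on {p..q} (\<lambda>p. v K p / a K p)"
    using continuous_on_impedance continuous_on_subset atLeastAtMost_subset_dom[OF p] by metis
qed

text \<open>Strict convexity of \<open>v\<close>, as \<open>v' = - (v / a)\<^sup>2\<close>.\<close>

lemma slope_increasing:
  assumes p: "p \<in> pdom K" and "p < q"
  shows "- (v K p)\<^sup>2 / (a K p)\<^sup>2 < - (v K q)\<^sup>2 / (a K q)\<^sup>2"
proof -
  have q: "q \<in> pdom K" using assms dom_upward by auto
  have "(v K q / a K q)\<^sup>2 < (v K p / a K p)\<^sup>2"
    using impedance_decreasing[OF assms] v_pos[OF q] a_pos[OF q]
    by (intro power_strict_mono) auto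
  then show ?thesis by (simp add: power_divide)
qed

lemma chord_slope:
  assumes p: "p \<in> pdom K" and "p < q"
  obtains c where "p < c" "c < q" "v K q - v K p = (q - p) * (- (v K c)\<^sup>2 / (a K c)\<^sup>2)"
proof -
  have "\<exists>l z. p < z \<and> z < q \<and> (v K has_real_derivative l) (at z) \<and> v K q - v K p = (q - p) * l"
  proof (rule MVT[OF \<open>p < q\<close>])
    show "continuous_on {p..q} (v K)"
      using continuous_on_volume continuous_on_subset atLeastAtMost_subset_dom[OF p] by metis
    show "v K differentiable at x" if "p < x" "x < q" for x
      using sound_speed[of x K] dom_upward[OF p] at_within_dom[OF p] that
      by (auto simp: real_differentiable_def)
  qed
  then obtain l z where z: "p < z" "z < q" "(v K has_real_derivative l) (at z)"
    "v K q - v K p = (q - p) * l" by blast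
  have "l = - (v K z)\<^sup>2 / (a K z)\<^sup>2"
    using sound_speed[of z K] z dom_upward[OF p] at_within_dom[OF p]
    by (auto intro: DERIV_unique)
  with z that show ?thesis by blast
qed

lemma volume_decreasing:
  assumes p: "p \<in> pdom K" and "p < q"
  shows "v K q < v K p"
proof -
  obtain c where c: "p < c" "v K q - v K p = (q - p) * (- (v K c)\<^sup>2 / (a K c)\<^sup>2)"
    using chord_slope[OF assms] .
  have "c \<in> pdom K" using c p dom_upward by auto
  then have "(q - p) * ((v K c)\<^sup>2 / (a K c)\<^sup>2) > 0"
    using v_pos[of c K] a_pos[of c K] \<open>p < q\<close> by simp
  then show ?thesis using c by simp
qed

text \<open>A chord of a strictly convex function has a slope strictly between the slopes at its
  ends. For a shock, the first bound becomes the Lax condition behind it, the second the one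
  ahead.\<close>

lemma chord_bounds:
  assumes p: "p \<in> pdom K" and "p < q"
  shows "(q - p) * ((v K q)\<^sup>2 / (a K q)\<^sup>2) < v K p - v K q"
    and "v K p - v K q < (q - p) * ((v K p)\<^sup>2 / (a K p)\<^sup>2)"
proof -
  obtain c where c: "p < c" "c < q" "v K q - v K p = (q - p) * (- (v K c)\<^sup>2 / (a K c)\<^sup>2)"
    using chord_slope[OF assms] .
  have "c \<in> pdom K" using c p dom_upward by auto
  from slope_increasing[OF p \<open>p < c\<close>] slope_increasing[OF this \<open>c < q\<close>]
  have "(v K q)\<^sup>2 / (a K q)\<^sup>2 < (v K c)\<^sup>2 / (a K c)\<^sup>2" "(v K c)\<^sup>2 / (a K c)\<^sup>2 < (v K p)\<^sup>2 / (a K p)\<^sup>2"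
    by simp_all
  from this[THEN mult_strict_left_mono, of "q - p"] \<open>p < q\<close>
  have "(q - p) * ((v K q)\<^sup>2 / (a K q)\<^sup>2) < (q - p) * ((v K c)\<^sup>2 / (a K c)\<^sup>2)"
    "(q - p) * ((v K c)\<^sup>2 / (a K c)\<^sup>2) < (q - p) * ((v K p)\<^sup>2 / (a K p)\<^sup>2)"
    by simp_all
  with c(3) show "(q - p) * ((v K q)\<^sup>2 / (a K q)\<^sup>2) < v K p - v K q"
    "v K p - v K q < (q - p) * ((v K p)\<^sup>2 / (a K p)\<^sup>2)"
    by auto
qed

text \<open>Because \<open>g' = v\<close>, the left-hand side is the integral of \<open>v\<close>,
  which the trapezoidal rule overestimates for strictly convex \<open>v\<close>. This fixes the sign
  of the entropy production of a shock.\<close>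

lemma gibbs_trapezoid:
  assumes p: "p \<in> pdom K" and "p < q"
  shows "g K q - g K p < (q - p) * (v K p + v K q) / 2"
proof -
  \<comment> \<open>\<open>F x\<close> is the trapezoidal error on \<open>{p..x}\<close>. Its
    derivative is half the value at \<open>p\<close> of the tangent to \<open>v\<close> at
    \<open>x\<close>, minus half of \<open>v K p\<close>, hence negative by convexity.\<close>
  define F where "F x = g K x - g K p - (x - p) * (v K p + v K x) / 2" for x
  have F': "(F has_real_derivative
      (v K x - v K p - (x - p) * (- (v K x)\<^sup>2 / (a K x)\<^sup>2)) / 2) (at x within pdom K)"
    if "x \<in> pdom K" for x
  proof -
    have "(F has_real_derivative (v K x - v K p - (x - p) * s) / 2) (at x within pdom K)"
      if "(v K has_real_derivative s) (at x within pdom K)" for s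
      unfolding F_def using \<open>x \<in> pdom K\<close> that
      by (auto intro!: derivative_eq_intros gibbs simp: field_simps)
    with sound_speed[OF that] show ?thesis by blast
  qed
  have "F q < F p"
  proof (rule DERIV_neg_imp_decreasing_open[OF \<open>p < q\<close>])
    fix x assume x: "p < x" "x < q"
    have "v K x - v K p - (x - p) * (- (v K x)\<^sup>2 / (a K x)\<^sup>2) < 0"
      using chord_bounds(1)[OF p x(1)] by simp
    then show "\<exists>y. (F has_real_derivative y) (at x) \<and> y < 0"
      using F'[of x] dom_upward[OF p, of x] at_within_dom[OF p x(1)] x
      by (intro exI[of _ "(v K x - v K p - (x - p) * (- (v K x)\<^sup>2 / (a K x)\<^sup>2)) / 2"])
        simp
  next
    have "continuous_on (pdom K) F"
      using F' by (metis DERIV_continuous continuous_on_eq_continuous_within)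
    then show "continuous_on {p..q} F"
      using continuous_on_subset atLeastAtMost_subset_dom[OF p] by metis
  qed
  then show ?thesis by (simp add: F_def)
qed

section \<open>Monotonicity of the wave functions\<close>

lemma impedance_integrable:
  assumes "p \<in> pdom K" shows "(\<lambda>\<zeta>. v K \<zeta> / a K \<zeta>) integrable_on {p..q}"
  by (rule integrable_continuous_interval)
    (rule continuous_on_subset[OF continuous_on_impedance atLeastAtMost_subset_dom[OF assms]])

lemma impedance_integral_pos:
  assumes p: "p \<in> pdom K" and "p < q"
  shows "integral {p..q} (\<lambda>\<zeta>. v K \<zeta> / a K \<zeta>) > 0"
proof -
  have q: "q \<in> pdom K" using assms dom_upward by auto
  have "(q - p) * (v K q / a K q) = integral {p..q} (\<lambda>\<zeta>. v K q / a K q)"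
    using \<open>p < q\<close> by simp
  also have "\<dots> \<le> integral {p..q} (\<lambda>\<zeta>. v K \<zeta> / a K \<zeta>)"
  proof (rule integral_le)
    fix x assume "x \<in> {p..q}"
    then show "v K q / a K q \<le> v K x / a K x"
      using impedance_decreasing[of x K q] dom_upward[OF p, of x] by (cases "x = q") auto
  qed (use impedance_integrable[OF p] in auto)
  finally show ?thesis
    using v_pos[OF q] a_pos[OF q] \<open>p < q\<close>
    by (smt (verit) divide_pos_pos mult_pos_pos)
qed

text \<open>On the rarefaction branch the increment is an integral of the positive impedance; on the
  shock branch both factors under the root grow; across the junction the value passes from
  nonpositive to positive.\<close>

lemma wave_fun_increasing:
  assumes p: "p \<in> pdom K" and "p < q" and s: "fst s \<in> pdom K"
  shows "wave_fun v a K p s < wave_fun v a K q s"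
proof -
  let ?I = "\<lambda>\<zeta>. v K \<zeta> / a K \<zeta>"
  have pos: "- (x - fst s) * (v K x - v K (fst s)) > 0" if "fst s < x" for x
    using volume_decreasing[OF s that] that by (simp add: mult_neg_neg)
  consider "q \<le> fst s" | "p \<le> fst s" "fst s < q" | "fst s < p" by linarith
  then show ?thesis
  proof cases
    case 1
    have "integral {p..q} ?I + integral {q..fst s} ?I = integral {p..fst s} ?I"
      using 1 \<open>p < q\<close> impedance_integrable[OF p]
      by (intro Henstock_Kurzweil_Integration.integral_combine) auto
    then show ?thesis
      using 1 impedance_integral_pos[OF p \<open>p < q\<close>] \<open>p < q\<close> by (simp add: wave_fun_def)
  next
    case 2
    have "integral {p..fst s} ?I \<ge> 0"
      using impedance_integral_pos[OF p, of "fst s"] 2 by (cases "p = fst s") auto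
    moreover have "sqrt (- (q - fst s) * (v K q - v K (fst s))) > 0"
      using pos[OF 2(2)] by simp
    ultimately have "- integral {p..fst s} ?I < sqrt (- (q - fst s) * (v K q - v K (fst s)))"
      by linarith
    then show ?thesis using 2 by (simp add: wave_fun_def)
  next
    case 3
    have "(p - fst s) * (v K (fst s) - v K p) < (q - fst s) * (v K (fst s) - v K q)"
      using 3 \<open>p < q\<close> volume_decreasing[OF p \<open>p < q\<close>] volume_decreasing[OF s 3]
      by (intro mult_strict_mono) auto
    then show ?thesis using 3 \<open>p < q\<close> by (simp add: wave_fun_def algebra_simps)
  qed
qed

section \<open>Shocks and rarefaction waves\<close>

lemma density_deriv:
  assumes P: "(P has_real_derivative P') (at \<xi>)" and X: "open X" "\<xi> \<in> X" "P ` X \<subseteq> pdom K"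
  shows "((\<lambda>\<xi>. density v K (P \<xi>)) has_real_derivative P' / (a K (P \<xi>))\<^sup>2) (at \<xi>)"
proof -
  have *: "P \<xi> \<in> pdom K" using X by auto
  from DERIV_divide[OF DERIV_const DERIV_chain_open[OF sound_speed[OF *] P X], of 1]
    v_pos[OF *] a_pos[OF *]
  show ?thesis by (simp add: density_def[abs_def] power2_eq_square)
qed

text \<open>On functions of \<xi> = x / t the two partial derivatives act as
  \<open>- \<xi> / t\<close> and \<open>1 / t\<close> times the derivative in \<xi>. Subtracting
  \<open>U\<close> times the mass equation from the momentum equation leaves the second equation of
  the system.\<close>

lemma isothermal_euler_iff:
  assumes P: "(P has_real_derivative P') (at (x / t))"
    and U: "(U has_real_derivative U') (at (x / t))"
    and X: "open X" "x / t \<in> X" "P ` X \<subseteq> pdom K" and t: "t > 0"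
  shows "isothermal_euler_at (\<lambda>t x. density v K (P (x / t))) (\<lambda>t x. U (x / t)) (\<lambda>t x. P (x / t)) t x \<longleftrightarrow>
    (U (x / t) - x / t) * P' / (a K (P (x / t)))\<^sup>2 + U' / v K (P (x / t)) = 0 \<and>
    (U (x / t) - x / t) * U' / v K (P (x / t)) + P' = 0"
proof -
  define \<xi> where "\<xi> = x / t"
  define R where "R \<xi> = density v K (P \<xi>)" for \<xi>
  define R' where "R' = P' / (a K (P \<xi>))\<^sup>2"
  have R: "(R has_real_derivative R') (at \<xi>)"
    unfolding R_def[abs_def] R'_def \<xi>_def by (rule density_deriv[OF P X])
  have sx: "((\<lambda>y. y / t) has_real_derivative 1 / t) (at x)"
    using t by (auto intro!: derivative_eq_intros)
  have st: "((\<lambda>s. x / s) has_real_derivative - \<xi> / t) (at t)"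
    using t by (auto intro!: derivative_eq_intros simp: \<xi>_def power2_eq_square)
  note in_x = DERIV_chain2[OF _ sx] and in_t = DERIV_chain2[OF _ st]
  note d = R P[folded \<xi>_def] U[folded \<xi>_def]
  have q: "((\<lambda>\<xi>. R \<xi> * U \<xi>) has_real_derivative R' * U \<xi> + R \<xi> * U') (at \<xi>)"
    by (auto intro!: derivative_eq_intros d)
  have F: "((\<lambda>\<xi>. R \<xi> * (U \<xi>)\<^sup>2 + P \<xi>) has_real_derivative
      R' * (U \<xi>)\<^sup>2 + 2 * R \<xi> * U \<xi> * U' + P') (at \<xi>)"
    by (auto intro!: derivative_eq_intros d simp: algebra_simps)
  \<comment> \<open>Uniqueness of derivatives eliminates the existential quantifiers of
    \<open>isothermal_euler_at\<close>.\<close>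
  have unique: "(f has_real_derivative e) (at y) \<longleftrightarrow> e = e'"
    if "(f has_real_derivative e') (at y)" for f e e' y
    using that by (auto dest: DERIV_unique)
  note ders = in_t[OF R[unfolded \<xi>_def]] in_x[OF q[unfolded \<xi>_def]]
    in_t[OF q[unfolded \<xi>_def]] in_x[OF F[unfolded \<xi>_def]]
  have "isothermal_euler_at (\<lambda>t x. R (x / t)) (\<lambda>t x. U (x / t)) (\<lambda>t x. P (x / t)) t x \<longleftrightarrow>
    R' * (- \<xi> / t) + (R' * U \<xi> + R \<xi> * U') * (1 / t) = 0 \<and>
    (R' * U \<xi> + R \<xi> * U') * (- \<xi> / t) + (R' * (U \<xi>)\<^sup>2 + 2 * R \<xi> * U \<xi> * U' + P') * (1 / t) = 0"
    unfolding isothermal_euler_at_def ders[THEN unique] by (simp add: \<xi>_def)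
  also have "\<dots> \<longleftrightarrow> (U \<xi> - \<xi>) * R' + R \<xi> * U' = 0 \<and>
     U \<xi> * ((U \<xi> - \<xi>) * R' + R \<xi> * U') + ((U \<xi> - \<xi>) * (R \<xi> * U') + P') = 0"
  proof -
    have "R' * (- \<xi> / t) + (R' * U \<xi> + R \<xi> * U') * (1 / t) = ((U \<xi> - \<xi>) * R' + R \<xi> * U') / t"
      by (simp add: diff_divide_distrib add_divide_distrib algebra_simps)
    moreover have "(R' * U \<xi> + R \<xi> * U') * (- \<xi> / t) +
        (R' * (U \<xi>)\<^sup>2 + 2 * R \<xi> * U \<xi> * U' + P') * (1 / t) =
      (U \<xi> * ((U \<xi> - \<xi>) * R' + R \<xi> * U') + ((U \<xi> - \<xi>) * (R \<xi> * U') + P')) / t"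
      by (simp add: diff_divide_distrib add_divide_distrib power2_eq_square algebra_simps)
    ultimately show ?thesis using t by simp
  qed
  also have "\<dots> \<longleftrightarrow> (U \<xi> - \<xi>) * R' + R \<xi> * U' = 0 \<and> (U \<xi> - \<xi>) * (R \<xi> * U') + P' = 0"
    by auto
  finally show ?thesis
    by (simp add: R_def R'_def \<xi>_def density_def)
qed

lemma admissible_subset_dom: "admissible_pressures pmin pt K \<subseteq> pdom K"
  by (cases K) auto

text \<open>
  A wave of orientation \<open>\<sigma> = 1\<close> moves to the left relative to the fluid, one of orientation
  \<open>\<sigma> = -1\<close> to the right; the state ahead of the wave is the left, respectively the right one. The
  inequalities are the Lax conditions.
\<close>

definition oriented_wave :: "real \<Rightarrow> phase \<Rightarrow> real \<Rightarrow> real \<Rightarrow> state \<Rightarrow> state \<Rightarrow> bool"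
  where "oriented_wave \<sigma> K l r s s' \<longleftrightarrow>
    l \<le> snd s - \<sigma> * a K (fst s) \<and> snd s' - \<sigma> * a K (fst s') \<le> r \<and>
    (if \<sigma> = 1 then r < snd s' \<and> snd s' = snd s - wave_fun v a K (fst s') s
     else \<sigma> = -1 \<and> snd s < l \<and> snd s = snd s' + wave_fun v a K (fst s) s')"

section \<open>Jump conditions and entropy-admissible shocks\<close>

text \<open>Here \<open>m\<close> is minus the mass flux. Mass and momentum balance turn the
  difference of kinetic energies into \<open>- (p' - p) * (v K p + v K p') / 2\<close>, so the
  entropy inequality compares the Gibbs increment with the trapezoidal rule.\<close>

lemma jump_conditions_iff:
  assumes d: "p \<in> pdom K" "p' \<in> pdom K"
  shows "jump_conditions v g W K (p, u) K (p', u') \<longleftrightarrow>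
    (\<exists>m. u - W = m * v K p \<and> u' - W = m * v K p' \<and> p' - p = m\<^sup>2 * (v K p - v K p') \<and>
      m * (g K p' - g K p - (p' - p) * (v K p + v K p') / 2) \<le> 0)"
    (is "?J \<longleftrightarrow> (\<exists>m. ?m m)")
proof -
  define m where "m = (u - W) / v K p"
  have flux: "u - W = m * v K p" "mass_flux v W K (p, u) = - m"
    using v_pos[OF d(1)] by (auto simp: m_def mass_flux_def density_def)
  have flux': "mass_flux v W K (p', u') + m = 0 \<longleftrightarrow> u' - W = m * v K p'"
    using v_pos[OF d(2)] by (auto simp: mass_flux_def density_def field_simps)
  have unique: "m' = m" if "u - W = m' * v K p" for m'
    using that v_pos[OF d(1)] by (simp add: m_def)
  have "?J \<longleftrightarrow> u' - W = m * v K p' \<and> m * (u' - u) + (p' - p) = 0 \<and>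
      - m * (g K p' + (u' - W)\<^sup>2 / 2 - (g K p + (u - W)\<^sup>2 / 2)) \<ge> 0"
    by (simp add: jump_conditions_def flux flux' del: mult_minus_left)
  also have "\<dots> \<longleftrightarrow> u' - W = m * v K p' \<and> p' - p = m\<^sup>2 * (v K p - v K p') \<and>
      m * (g K p' - g K p - (p' - p) * (v K p + v K p') / 2) \<le> 0"
  proof (rule conj_cong[OF refl])
    assume u': "u' - W = m * v K p'"
    have "u' - u = m * v K p' - m * v K p" using u' flux(1) by linarith
    then have "m * (u' - u) = - (m\<^sup>2 * (v K p - v K p'))"
      by (simp only:) (simp add: power2_eq_square algebra_simps)
    then have mom: "m * (u' - u) + (p' - p) = 0 \<longleftrightarrow> p' - p = m\<^sup>2 * (v K p - v K p')"
      by auto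
    have "g K p' + (u' - W)\<^sup>2 / 2 - (g K p + (u - W)\<^sup>2 / 2)
        = g K p' - g K p - (p' - p) * (v K p + v K p') / 2"
      if "p' - p = m\<^sup>2 * (v K p - v K p')"
    proof -
      have "(u' - W)\<^sup>2 - (u - W)\<^sup>2 = - ((p' - p) * (v K p + v K p'))"
        unfolding u' flux that by (simp add: power2_eq_square algebra_simps)
      then show ?thesis by linarith
    qed
    note bracket = this
    show "m * (u' - u) + (p' - p) = 0 \<and>
        - m * (g K p' + (u' - W)\<^sup>2 / 2 - (g K p + (u - W)\<^sup>2 / 2)) \<ge> 0 \<longleftrightarrow>
      p' - p = m\<^sup>2 * (v K p - v K p') \<and>
        m * (g K p' - g K p - (p' - p) * (v K p + v K p') / 2) \<le> 0"
      unfolding mom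
      by (rule conj_cong[OF refl]) (simp only: bracket mult_minus_left neg_0_le_iff_le)
  qed
  also have "\<dots> \<longleftrightarrow> ?m m" using flux by simp
  also have "\<dots> \<longleftrightarrow> (\<exists>m. ?m m)" using unique by blast
  finally show ?thesis .
qed

text \<open>Equal pressures give equal states. Otherwise \<open>gibbs_trapezoid\<close> fixes the
  sign of \<open>m\<close>: the fluid enters the shock from the low-pressure side. The momentum
  balance inserted into \<open>chord_bounds\<close> then makes the relative flow supersonic ahead
  and subsonic behind.\<close>

lemma shock_cases:
  assumes shock: "jump_conditions v g W K s K s'"
    and dom: "fst s \<in> pdom K" "fst s' \<in> pdom K"
  shows "s = s' \<or> oriented_wave 1 K W W s s' \<or> oriented_wave (-1) K W W s s'"
proof -
  obtain p u where s: "s = (p, u)" by (cases s)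
  obtain p' u' where s': "s' = (p', u')" by (cases s')
  note d = dom[unfolded s s' fst_conv]
  obtain m where m: "u - W = m * v K p" "u' - W = m * v K p'"
    and mom': "p' - p = m\<^sup>2 * (v K p - v K p')"
    and ent: "m * (g K p' - g K p - (p' - p) * (v K p + v K p') / 2) \<le> 0"
    using shock unfolding s s' jump_conditions_iff[OF d] by blast
  have compressive: "m > 0" if "p < p'" "m \<noteq> 0"
    using gibbs_trapezoid[OF d(1) that(1)] ent that(2) by (auto simp: mult_le_0_iff)
  have compressive': "m < 0" if "p' < p" "m \<noteq> 0"
  proof -
    have "g K p' - g K p - (p' - p) * (v K p + v K p') / 2 > 0"
      using gibbs_trapezoid[OF d(2) that(1)] by (simp add: algebra_simps add_divide_distrib diff_divide_distrib)
    then show ?thesis using ent that(2) by (auto simp: mult_le_0_iff)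
  qed
  \<comment> \<open>\<open>D\<close> is the drop in volume, \<open>M\<close> the size of the mass
    flux, \<open>x\<close> the volume and \<open>y\<close> the sound speed. Division by
    \<open>D\<close> shows that the relative Mach number \<open>M * x / y\<close> exceeds 1; in
    \<open>behind\<close> it stays below 1.\<close>
  have ahead: "y < M * x" if "D < M\<^sup>2 * D * (x\<^sup>2 / y\<^sup>2)" "D > 0" "x > 0" "y > 0" "M > 0"
    for D M x y :: real
  proof -
    have "D * 1 < D * (M * x / y)\<^sup>2"
      using that(1) by (simp add: power_divide power_mult_distrib mult_ac)
    then have "1\<^sup>2 < (M * x / y)\<^sup>2"
      using that(2) by (simp only: mult_less_cancel_left_pos) simp
    then have "1 < M * x / y"
      by (rule power2_less_imp_less) (use that in simp)
    then show ?thesis using that(4) by simp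
  qed
  have behind: "M * x < y" if "M\<^sup>2 * D * (x\<^sup>2 / y\<^sup>2) < D" "D > 0" "x > 0" "y > 0" "M > 0"
    for D M x y :: real
  proof -
    have "D * (M * x / y)\<^sup>2 < D * 1"
      using that(1) by (simp add: power_divide power_mult_distrib mult_ac)
    then have "(M * x / y)\<^sup>2 < 1\<^sup>2"
      using that(2) by (simp only: mult_less_cancel_left_pos) simp
    then have "M * x / y < 1"
      by (rule power2_less_imp_less) simp
    then show ?thesis using that(4) by simp
  qed
  consider "p = p'" | "p < p'" | "p' < p" by linarith
  then show ?thesis
  proof cases
    case 1
    then show ?thesis using m by (simp add: s s')
  next
    case 2
    then have "m \<noteq> 0" using mom' by auto
    with 2 have "m > 0" using compressive by auto
    have drop: "v K p - v K p' > 0" using volume_decreasing[OF d(1) 2] by simp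
    have "a K p < m * v K p"
      using ahead[OF chord_bounds(2)[OF d(1) 2, unfolded mom'] drop v_pos[OF d(1)] a_pos[OF d(1)]]
        \<open>m > 0\<close> by simp
    moreover have "m * v K p' < a K p'"
      using behind[OF chord_bounds(1)[OF d(1) 2, unfolded mom'] drop v_pos[OF d(2)] a_pos[OF d(2)]]
        \<open>m > 0\<close> by simp
    moreover have "u' = u - sqrt (- (p' - p) * (v K p' - v K p))"
    proof -
      have "- (p' - p) * (v K p' - v K p) = (m * (v K p - v K p'))\<^sup>2"
        unfolding mom' by (simp add: power2_eq_square algebra_simps)
      then have "sqrt (- (p' - p) * (v K p' - v K p)) = m * (v K p - v K p')"
        using drop \<open>m > 0\<close> by (simp add: real_sqrt_abs)
      then show ?thesis using m by (simp add: algebra_simps)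
    qed
    moreover have "W < u'" using m(2) mult_pos_pos[OF \<open>m > 0\<close> v_pos[OF d(2)]] by linarith
    ultimately have "oriented_wave 1 K W W s s'"
      using 2 m by (simp add: oriented_wave_def s s' wave_fun_def)
    then show ?thesis by simp
  next
    case 3
    then have "m \<noteq> 0" using mom' by auto
    with 3 have "m < 0" using compressive' by auto
    have drop: "v K p' - v K p > 0" using volume_decreasing[OF d(2) 3] by simp
    have mom'': "p - p' = (- m)\<^sup>2 * (v K p' - v K p)" using mom' by (simp add: algebra_simps)
    have "a K p' < - m * v K p'"
      using ahead[OF chord_bounds(2)[OF d(2) 3, unfolded mom''] drop v_pos[OF d(2)] a_pos[OF d(2)]]
        \<open>m < 0\<close> by simp
    moreover have "- m * v K p < a K p"
      using behind[OF chord_bounds(1)[OF d(2) 3, unfolded mom''] drop v_pos[OF d(1)] a_pos[OF d(1)]]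
        \<open>m < 0\<close> by simp
    moreover have "u = u' + sqrt (- (p - p') * (v K p - v K p'))"
    proof -
      have "- (p - p') * (v K p - v K p') = (- m * (v K p' - v K p))\<^sup>2"
        unfolding mom'' by (simp add: power2_eq_square algebra_simps)
      then have "sqrt (- (p - p') * (v K p - v K p')) = \<bar>- m * (v K p' - v K p)\<bar>"
        by (simp only: real_sqrt_abs)
      also have "\<dots> = - m * (v K p' - v K p)"
        using drop \<open>m < 0\<close> by (simp add: abs_mult)
      finally show ?thesis using m by (simp add: algebra_simps)
    qed
    moreover have "u < W" using m(1) mult_neg_pos[OF \<open>m < 0\<close> v_pos[OF d(1)]] by linarith
    ultimately have "oriented_wave (-1) K W W s s'"
      using 3 m by (simp add: oriented_wave_def s s' wave_fun_def)
    then show ?thesis by simp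
  qed
qed

section \<open>Rarefaction waves determine their orientation\<close>

text \<open>A primitive \<Phi> that can be composed with a pressure profile;
  \<open>u + \<sigma> * \<Phi> p\<close> will be the Riemann invariant of a fan, and differences of
  \<Phi> recover the integrals in \<open>wave_fun\<close>.\<close>

lemma impedance_antiderivative:
  assumes b: "b \<in> pdom K"
  obtains \<Phi> where
    "\<And>x. x \<in> {b..c} \<Longrightarrow> (\<Phi> has_real_derivative v K x / a K x) (at x within {b..c})"
    "\<And>x y. b \<le> x \<Longrightarrow> x \<le> y \<Longrightarrow> y \<le> c \<Longrightarrow> integral {x..y} (\<lambda>\<zeta>. v K \<zeta> / a K \<zeta>) = \<Phi> y - \<Phi> x"
proof -
  have "continuous_on {b..c} (\<lambda>\<zeta>. v K \<zeta> / a K \<zeta>)"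
    by (rule continuous_on_subset[OF continuous_on_impedance atLeastAtMost_subset_dom[OF b]])
  then obtain \<Phi> where \<Phi>: "\<And>x. x \<in> {b..c} \<Longrightarrow>
      (\<Phi> has_vector_derivative v K x / a K x) (at x within {b..c})"
    using antiderivative_continuous by blast
  have "integral {x..y} (\<lambda>\<zeta>. v K \<zeta> / a K \<zeta>) = \<Phi> y - \<Phi> x" if "b \<le> x" "x \<le> y" "y \<le> c" for x y
    using that by (intro integral_unique fundamental_theorem_of_calculus)
      (auto intro: has_vector_derivative_within_subset[OF \<Phi>])
  with \<Phi> that show ?thesis
    by (auto simp: has_real_derivative_iff_has_vector_derivative)
qed

text \<open>The fan equations are linear and homogeneous in \<open>P'\<close> and \<open>U'\<close>,
  so the absence of stationary points forces their determinant to vanish: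
  \<open>(U - \<xi>)\<^sup>2 = a\<^sup>2\<close>. The sign of \<open>U - \<xi>\<close> is the
  orientation.\<close>

lemma rarefaction_cases:
  assumes wave: "rarefaction_wave v pmin pt K P U l r s s'"
  shows "oriented_wave 1 K l r s s' \<or> oriented_wave (-1) K l r s s'"
proof -
  have "l < r" and cont: "continuous_on {l..r} P" "continuous_on {l..r} U"
    and s: "s = (P l, U l)" "s' = (P r, U r)"
    and adm: "\<And>\<xi>. \<xi> \<in> {l..r} \<Longrightarrow> P \<xi> \<in> pdom K"
    using wave admissible_subset_dom[of pt K] by (auto simp: rarefaction_wave_def)
  \<comment> \<open>\<Phi> is needed on the whole range of \<open>P\<close>, as monotonicity of the
    pressure is not yet known.\<close>
  obtain b c where bc: "P ` {l..r} = {b..c}" "b \<le> c"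
    using continuous_image_closed_interval[of l r P] \<open>l < r\<close> cont by auto
  have b: "b \<in> pdom K" using bc adm by (metis atLeastAtMost_iff imageE order_refl)
  have X: "P ` {l<..<r} \<subseteq> pdom K" "P ` {l<..<r} \<subseteq> {b..c}"
    using adm bc(1) by (auto simp flip: bc(1))
  obtain \<Phi> where \<Phi>:
    "\<And>x. x \<in> {b..c} \<Longrightarrow> (\<Phi> has_real_derivative v K x / a K x) (at x within {b..c})"
    "\<And>x y. b \<le> x \<Longrightarrow> x \<le> y \<Longrightarrow> y \<le> c \<Longrightarrow> integral {x..y} (\<lambda>\<zeta>. v K \<zeta> / a K \<zeta>) = \<Phi> y - \<Phi> x"
    using impedance_antiderivative[OF b] by metis
  have ode: "\<exists>P' U'. (P has_real_derivative P') (at \<xi>) \<and> (U has_real_derivative U') (at \<xi>) \<and>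
      P' \<noteq> 0 \<and> (U \<xi> - \<xi>)\<^sup>2 = (a K (P \<xi>))\<^sup>2 \<and>
      (U \<xi> - \<xi>) * P' / (a K (P \<xi>))\<^sup>2 + U' / v K (P \<xi>) = 0"
    if \<xi>: "\<xi> \<in> {l<..<r}" for \<xi>
  proof -
    obtain P' U' where d: "(P has_real_derivative P') (at \<xi>)" "(U has_real_derivative U') (at \<xi>)"
      "P' \<noteq> 0 \<or> U' \<noteq> 0"
      using wave \<xi> unfolding rarefaction_wave_def by blast
    have "isothermal_euler_at (\<lambda>t x. density v K (P (x / t))) (\<lambda>t x. U (x / t)) (\<lambda>t x. P (x / t)) 1 \<xi>"
      using wave \<xi> by (auto simp: rarefaction_wave_def)
    then have e: "(U \<xi> - \<xi>) * P' / (a K (P \<xi>))\<^sup>2 + U' / v K (P \<xi>) = 0"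
        "(U \<xi> - \<xi>) * U' / v K (P \<xi>) + P' = 0"
      using isothermal_euler_iff[of P P' \<xi> 1 U U' "{l<..<r}" K] d(1,2) \<xi> X(1) by simp_all
    have pos: "v K (P \<xi>) > 0" "a K (P \<xi>) > 0" using adm[of \<xi>] \<xi> v_pos a_pos by auto
    \<comment> \<open>With \<open>P' = 0\<close> the mass equation would give \<open>U' = 0\<close>
      as well.\<close>
    have "P' \<noteq> 0" using d(3) e pos by auto
    have "(U \<xi> - \<xi>)\<^sup>2 * P' / (a K (P \<xi>))\<^sup>2 = - ((U \<xi> - \<xi>) * U' / v K (P \<xi>))"
      using arg_cong[OF e(1), of "\<lambda>x. (U \<xi> - \<xi>) * x"]
      by (simp add: power2_eq_square algebra_simps)
    then have "(U \<xi> - \<xi>)\<^sup>2 * P' / (a K (P \<xi>))\<^sup>2 = P'" using e(2) by simp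
    then have "(U \<xi> - \<xi>)\<^sup>2 = (a K (P \<xi>))\<^sup>2" using \<open>P' \<noteq> 0\<close> pos by (simp add: field_simps)
    with d \<open>P' \<noteq> 0\<close> e(1) show ?thesis by blast
  qed
  \<comment> \<open>\<open>w\<close> is the signed relative Mach number. Its square is 1, at the
    edges by continuity; being continuous with finite range on an interval it is constant, so the
    orientation cannot switch inside the fan.\<close>
  define w where "w \<xi> = (U \<xi> - \<xi>) / a K (P \<xi>)" for \<xi>
  have apos: "a K (P \<xi>) > 0" if "\<xi> \<in> {l..r}" for \<xi> using adm[OF that] a_pos by auto
  have cont_aP: "continuous_on {l..r} (\<lambda>\<xi>. a K (P \<xi>))"
    by (rule continuous_on_compose2[OF continuous_on_sound_speed cont(1)]) (use adm in auto)
  have cont_w: "continuous_on {l..r} w"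
    unfolding w_def using apos by (intro continuous_intros cont cont_aP) force
  have w2: "(w \<xi>)\<^sup>2 = 1" if "\<xi> \<in> {l..r}" for \<xi>
  proof (rule continuous_constant_on_closure[where S = "{l<..<r}" and f = "\<lambda>\<xi>. (w \<xi>)\<^sup>2"])
    show "continuous_on (closure {l<..<r}) (\<lambda>\<xi>. (w \<xi>)\<^sup>2)" "\<xi> \<in> closure {l<..<r}"
      using \<open>l < r\<close> cont_w that by (auto intro: continuous_intros)
    show "(w x)\<^sup>2 = 1" if "x \<in> {l<..<r}" for x
      using ode[OF that] apos[of x] that by (auto simp: w_def power_divide)
  qed
  then have "w ` {l..r} \<subseteq> {1, -1}" unfolding power2_eq_1_iff by blast
  then have "w constant_on {l..r}"
    by (intro continuous_finite_range_constant cont_w) (auto intro: finite_subset)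
  then obtain \<sigma> where \<sigma>: "\<And>\<xi>. \<xi> \<in> {l..r} \<Longrightarrow> w \<xi> = \<sigma>" by (auto simp: constant_on_def)
  have "\<sigma> = 1 \<or> \<sigma> = -1" using w2[of l] \<sigma>[of l] \<open>l < r\<close> by (simp add: power2_eq_1_iff)
  have U: "U \<xi> - \<xi> = \<sigma> * a K (P \<xi>)" if "\<xi> \<in> {l..r}" for \<xi>
    using \<sigma>[OF that] apos[OF that] by (simp add: w_def field_simps)
  have der: "\<exists>P'. (P has_real_derivative P') (at \<xi>) \<and>
      (U has_real_derivative - \<sigma> * (v K (P \<xi>) / a K (P \<xi>)) * P') (at \<xi>) \<and> \<sigma> * P' < 0"
    if \<xi>: "\<xi> \<in> {l<..<r}" for \<xi>
  proof -
    have P\<xi>: "P \<xi> \<in> pdom K" and \<xi>': "\<xi> \<in> {l..r}" using \<xi> adm by auto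
    have pos: "v K (P \<xi>) > 0" "a K (P \<xi>) > 0" using P\<xi> v_pos a_pos by auto
    obtain P' U' where d: "(P has_real_derivative P') (at \<xi>)" "(U has_real_derivative U') (at \<xi>)"
      and e: "(U \<xi> - \<xi>) * P' / (a K (P \<xi>))\<^sup>2 + U' / v K (P \<xi>) = 0"
      using ode[OF \<xi>] by blast
    have U': "U' = - \<sigma> * (v K (P \<xi>) / a K (P \<xi>)) * P'"
      using e pos by (simp add: U[OF \<xi>'] field_simps power2_eq_square)
    obtain d' where d': "(a K has_real_derivative d') (at (P \<xi>) within pdom K)"
      "v K (P \<xi>) / a K (P \<xi>) + d' > 0"
      using sound_speed_derivative[OF P\<xi>] .
    have aP: "((\<lambda>\<xi>. a K (P \<xi>)) has_real_derivative d' * P') (at \<xi>)"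
      using DERIV_chain_open[OF d'(1) d(1) _ \<xi> X(1)] by simp
    have "((\<lambda>\<xi>. U \<xi> - \<sigma> * a K (P \<xi>)) has_real_derivative U' - \<sigma> * (d' * P')) (at \<xi>)"
      by (auto intro!: derivative_eq_intros d aP)
    \<comment> \<open>On the fan this function is the identity. Equating its two derivatives yields
      \<open>(v / a + a') * (\<sigma> * P') = -1\<close>, so positivity of \<G> fixes the sign of
      \<open>P'\<close>.\<close>
    moreover have "((\<lambda>\<xi>. U \<xi> - \<sigma> * a K (P \<xi>)) has_real_derivative 1) (at \<xi>)"
      by (rule has_field_derivative_transform_within_open[OF DERIV_ident, of "{l<..<r}"])
        (use U \<xi> in \<open>auto simp: algebra_simps\<close>)
    ultimately have "U' - \<sigma> * (d' * P') = 1" by (rule DERIV_unique)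
    then have "- ((v K (P \<xi>) / a K (P \<xi>) + d') * (\<sigma> * P')) = 1"
      by (simp add: U' algebra_simps)
    then have "(v K (P \<xi>) / a K (P \<xi>) + d') * (\<sigma> * P') < 0" by linarith
    then have "\<sigma> * P' < 0" using d'(2) by (simp only: mult_less_0_iff) linarith
    then show ?thesis using d U' by blast
  qed
  have mono: "\<sigma> * P r < \<sigma> * P l"
  proof (rule DERIV_neg_imp_decreasing_open[OF \<open>l < r\<close>])
    show "\<exists>y. ((\<lambda>\<xi>. \<sigma> * P \<xi>) has_real_derivative y) (at x) \<and> y < 0" if "l < x" "x < r" for x
      using der[of x] that by (auto intro: DERIV_cmult)
  qed (intro continuous_intros cont)
  \<comment> \<open>Constancy of the Riemann invariant, from
    \<open>U' = - \<sigma> * (v / a) * P'\<close>.\<close>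
  have "U r + \<sigma> * \<Phi> (P r) = U l + \<sigma> * \<Phi> (P l)"
  proof (rule DERIV_isconst_end[OF \<open>l < r\<close>])
    have "continuous_on {b..c} \<Phi>"
      using \<Phi>(1) by (metis DERIV_continuous continuous_on_eq_continuous_within)
    then have "continuous_on {l..r} (\<lambda>\<xi>. \<Phi> (P \<xi>))"
      by (rule continuous_on_compose2[OF _ cont(1)]) (use bc in auto)
    then show "continuous_on {l..r} (\<lambda>\<xi>. U \<xi> + \<sigma> * \<Phi> (P \<xi>))"
      by (intro continuous_intros cont)
    show "((\<lambda>\<xi>. U \<xi> + \<sigma> * \<Phi> (P \<xi>)) has_real_derivative 0) (at x)" if "l < x" "x < r" for x
    proof -
      have x: "x \<in> {l<..<r}" using that by simp
      obtain P' where P': "(P has_real_derivative P') (at x)"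
        "(U has_real_derivative - \<sigma> * (v K (P x) / a K (P x)) * P') (at x)"
        using der[OF x] by blast
      have "P x \<in> {b..c}" using X(2) x by blast
      then have "((\<lambda>\<xi>. \<Phi> (P \<xi>)) has_real_derivative v K (P x) / a K (P x) * P') (at x)"
        by (intro DERIV_chain_open[OF \<Phi>(1) P'(1) open_greaterThanLessThan x X(2)])
      from DERIV_add[OF P'(2) DERIV_cmult[OF this, of \<sigma>]] show ?thesis by simp
    qed
  qed
  moreover have "P l \<in> {b..c}" "P r \<in> {b..c}" using bc(1) \<open>l < r\<close> by (auto simp flip: bc(1))
  ultimately show ?thesis
    using \<open>\<sigma> = 1 \<or> \<sigma> = -1\<close> mono U[of l] U[of r] apos[of l] apos[of r] \<open>l < r\<close>
    by (auto simp: oriented_wave_def wave_fun_def s \<Phi>(2))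
qed

lemma classical_wave_cases:
  assumes "classical_wave v g pmin pt K P U l r s s'" "fst s \<in> pdom K" "fst s' \<in> pdom K"
  shows "s = s' \<or> oriented_wave 1 K l r s s' \<or> oriented_wave (-1) K l r s s'"
  using assms shock_cases rarefaction_cases unfolding classical_wave_def by blast

section \<open>Construction of waves\<close>

text \<open>
  Along the wave fan the velocity is \<open>u = w x\<close> as a function of the pressure \<open>x\<close>, and
  \<open>\<xi> = w x - \<sigma> a x\<close>, which is strictly monotone because \<open>\<G> > 0\<close>; the pressure profile is its inverse.
\<close>

lemma rarefaction_exists:
  assumes q: "q \<in> pdom K" and "q < p" and adm: "{q..p} \<subseteq> admissible_pressures pmin pt K"
    and u: "uq = up + \<sigma> * integral {q..p} (\<lambda>\<zeta>. v K \<zeta> / a K \<zeta>)"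
    and \<sigma>: "\<sigma> = 1 \<and> s = (p, up) \<and> s' = (q, uq) \<or> \<sigma> = -1 \<and> s = (q, uq) \<and> s' = (p, up)"
  defines "l \<equiv> snd s - \<sigma> * a K (fst s)" and "r \<equiv> snd s' - \<sigma> * a K (fst s')"
  shows "l < r"
    and "\<exists>P0 U0. \<forall>P U. (\<forall>\<xi>\<in>{l..r}. P \<xi> = P0 \<xi> \<and> U \<xi> = U0 \<xi>) \<longrightarrow>
      rarefaction_wave v pmin pt K P U l r s s'"
proof -
  have \<sigma>2: "\<sigma> * \<sigma> = 1" using \<sigma> by auto
  obtain \<Phi> where \<Phi>:
    "\<And>x. x \<in> {q..p} \<Longrightarrow> (\<Phi> has_real_derivative v K x / a K x) (at x within {q..p})"
    "\<And>x y. q \<le> x \<Longrightarrow> x \<le> y \<Longrightarrow> y \<le> p \<Longrightarrow> integral {x..y} (\<lambda>\<zeta>. v K \<zeta> / a K \<zeta>) = \<Phi> y - \<Phi> x"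
    using impedance_antiderivative[OF q] by metis
  have cont_\<Phi>: "continuous_on {q..p} \<Phi>"
    using \<Phi>(1) by (metis DERIV_continuous continuous_on_eq_continuous_within)
  have dom: "x \<in> pdom K" if "x \<in> {q..p}" for x using that q dom_upward by auto
  have \<Phi>_at: "(\<Phi> has_real_derivative v K x / a K x) (at x)" if "q < x" "x < p" for x
    using \<Phi>(1)[of x] that at_within_interior[of x "{q..p}"] by simp
  \<comment> \<open>\<open>w\<close> is the velocity given by the Riemann invariant.
    \<open>H\<close> below equals \<open>- \<sigma> * \<xi>\<close>; with this sign it is increasing
    for both orientations, with derivative \<open>v / a + a'\<close>.\<close>
  define w where "w x = up + \<sigma> * (\<Phi> p - \<Phi> x)" for x
  define H where "H x = a K x - \<sigma> * w x" for x
  have w_ends: "w p = up" "w q = uq"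
    using u \<Phi>(2)[of q p] \<open>q < p\<close> by (simp_all add: w_def)
  have "\<exists>H'. \<forall>x. q < x \<and> x < p \<longrightarrow> (H has_real_derivative H' x) (at x) \<and> H' x > 0"
  proof -
    have "\<exists>y. (H has_real_derivative y) (at x) \<and> y > 0" if "q < x" "x < p" for x
    proof -
      obtain d where d: "(a K has_real_derivative d) (at x within pdom K)" "v K x / a K x + d > 0"
        using sound_speed_derivative[of x K] dom[of x] \<open>q < x\<close> \<open>x < p\<close> by auto
      have "(H has_real_derivative d - \<sigma> * (\<sigma> * (0 - v K x / a K x))) (at x)"
        unfolding H_def w_def using d(1) \<Phi>_at[OF that] at_within_dom[OF q \<open>q < x\<close>]
        by (auto intro!: derivative_eq_intros)
      moreover have "d - \<sigma> * (\<sigma> * (0 - v K x / a K x)) = v K x / a K x + d"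
        by (simp add: mult.assoc[symmetric] \<sigma>2)
      ultimately show ?thesis using d(2) by metis
    qed
    then show ?thesis by metis
  qed
  then obtain H' where H': "\<And>x. q < x \<Longrightarrow> x < p \<Longrightarrow> (H has_real_derivative H' x) (at x)"
    "\<And>x. q < x \<Longrightarrow> x < p \<Longrightarrow> H' x > 0" by blast
  have contH: "continuous_on {q..p} H"
    unfolding H_def w_def
    by (intro continuous_intros cont_\<Phi> continuous_on_subset[OF continuous_on_sound_speed]) (use dom in auto)
  obtain G where Hqp: "H q < H p" and contG: "continuous_on {H q..H p} G"
    and G_ends: "G (H q) = q" "G (H p) = p"
    and G: "\<And>y. y \<in> {H q..H p} \<Longrightarrow> G y \<in> {q..p} \<and> H (G y) = y"
    and G_int: "\<And>y. y \<in> {H q<..<H p} \<Longrightarrow> G y \<in> {q<..<p}"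
    and G': "\<And>y. y \<in> {H q<..<H p} \<Longrightarrow> (G has_real_derivative inverse (H' (G y))) (at y)"
    using increasing_inverse[OF \<open>q < p\<close> contH H'] by metis
  \<comment> \<open>A left-facing fan has its high-pressure end on the left, so its sector is the
    reflected range of \<open>H\<close>.\<close>
  have lr: "\<sigma> = 1 \<and> l = - H p \<and> r = - H q \<or> \<sigma> = -1 \<and> l = H q \<and> r = H p"
    using \<sigma> w_ends by (auto simp: l_def r_def H_def)
  show "l < r" using lr Hqp by auto
  define P0 where "P0 \<xi> = G (- \<sigma> * \<xi>)" for \<xi>
  define U0 where "U0 \<xi> = w (P0 \<xi>)" for \<xi>
  have dom_flip: "- \<sigma> * \<xi> \<in> {H q..H p}" if "\<xi> \<in> {l..r}" for \<xi> using that lr by auto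
  have dom_flip_int: "- \<sigma> * \<xi> \<in> {H q<..<H p}" if "\<xi> \<in> {l<..<r}" for \<xi> using that lr by auto
  have P0: "P0 \<xi> \<in> {q..p}" "H (P0 \<xi>) = - \<sigma> * \<xi>" if "\<xi> \<in> {l..r}" for \<xi>
    using G[OF dom_flip[OF that]] by (auto simp: P0_def)
  have speed: "U0 \<xi> - \<xi> = \<sigma> * a K (P0 \<xi>)" if "\<xi> \<in> {l..r}" for \<xi>
    using P0(2)[OF that] lr by (auto simp: U0_def H_def)
  have cont_P0: "continuous_on {l..r} P0"
    unfolding P0_def
    by (rule continuous_on_compose2[OF contG]) (use dom_flip in \<open>auto intro!: continuous_intros\<close>)
  have cont_U0: "continuous_on {l..r} U0"
    unfolding U0_def w_def
    by (intro continuous_intros continuous_on_compose2[OF cont_\<Phi> cont_P0]) (use P0 in auto)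
  have "P0 l = fst s" "P0 r = fst s'"
    using lr \<sigma> G_ends by (auto simp: P0_def)
  moreover from this have "U0 l = snd s" "U0 r = snd s'"
    using \<sigma> w_ends by (auto simp: U0_def)
  ultimately have ends: "(P0 l, U0 l) = s" "(P0 r, U0 r) = s'" by auto
  have der: "\<exists>P'. P' \<noteq> 0 \<and> (P0 has_real_derivative P') (at \<xi>) \<and>
      (U0 has_real_derivative - \<sigma> * (v K (P0 \<xi>) / a K (P0 \<xi>)) * P') (at \<xi>)"
    if "\<xi> \<in> {l<..<r}" for \<xi>
  proof -
    have int: "P0 \<xi> \<in> {q<..<p}" using G_int[OF dom_flip_int[OF that]] by (simp add: P0_def)
    have *: "(P0 has_real_derivative inverse (H' (P0 \<xi>)) * (- \<sigma>)) (at \<xi>)"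
      unfolding P0_def
      by (rule DERIV_chain2[where f = G and g = "\<lambda>\<xi>. - \<sigma> * \<xi>", OF G'[OF dom_flip_int[OF that]]])
        (auto intro!: derivative_eq_intros)
    have "(U0 has_real_derivative - \<sigma> * (v K (P0 \<xi>) / a K (P0 \<xi>)) * (inverse (H' (P0 \<xi>)) * (- \<sigma>))) (at \<xi>)"
      unfolding U0_def w_def using int
      by (auto intro!: derivative_eq_intros DERIV_chain2[OF \<Phi>_at *])
    moreover have "inverse (H' (P0 \<xi>)) * (- \<sigma>) \<noteq> 0"
      using H'(2)[of "P0 \<xi>"] int \<sigma> by auto
    ultimately show ?thesis using * by blast
  qed
  \<comment> \<open>Derivatives inside the sector depend only on values there, so every profile
    agreeing with \<open>P0\<close> and \<open>U0\<close> on \<open>{l..r}\<close> is a fan too.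
    This allows fans to be glued to constant states.\<close>
  have "rarefaction_wave v pmin pt K P U l r s s'"
    if agree: "\<forall>\<xi>\<in>{l..r}. P \<xi> = P0 \<xi> \<and> U \<xi> = U0 \<xi>" for P U
  proof -
    have der': "\<exists>P'. P' \<noteq> 0 \<and> (P has_real_derivative P') (at \<xi>) \<and>
      (U has_real_derivative - \<sigma> * (v K (P \<xi>) / a K (P \<xi>)) * P') (at \<xi>)"
      if \<xi>: "\<xi> \<in> {l<..<r}" for \<xi>
    proof -
      have "P0 x = P x" "U0 x = U x" if "x \<in> {l<..<r}" for x using agree that by auto
      note transfer = has_field_derivative_transform_within_open[OF _ open_greaterThanLessThan \<xi>]
      from der[OF \<xi>] show ?thesis
        using transfer[of P0 _ P] transfer[of U0 _ U] \<open>\<And>x. x \<in> {l<..<r} \<Longrightarrow> P0 x = P x\<close>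
          \<open>\<And>x. x \<in> {l<..<r} \<Longrightarrow> U0 x = U x\<close> \<xi> by metis
    qed
    have cont: "continuous_on {l..r} P" "continuous_on {l..r} U"
      using continuous_on_eq[OF cont_P0, of P] continuous_on_eq[OF cont_U0, of U] agree by auto
    have admP: "P \<xi> \<in> admissible_pressures pmin pt K" if "\<xi> \<in> {l..r}" for \<xi>
      using P0(1)[OF that] adm agree that by auto
    have "isothermal_euler_at (\<lambda>t x. density v K (P (x / t))) (\<lambda>t x. U (x / t)) (\<lambda>t x. P (x / t)) t x"
      if "t > 0" "l < x / t" "x / t < r" for t x
    proof -
      have \<xi>: "x / t \<in> {l<..<r}" using that by auto
      have \<xi>': "x / t \<in> {l..r}" using that by auto
      have X: "P ` {l<..<r} \<subseteq> pdom K"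
        using admP admissible_subset_dom[of pt K] by force
      have pos: "v K (P (x / t)) > 0" "a K (P (x / t)) > 0"
        using X \<xi> v_pos a_pos by blast+
      obtain P' where P': "(P has_real_derivative P') (at (x / t))"
        "(U has_real_derivative - \<sigma> * (v K (P (x / t)) / a K (P (x / t))) * P') (at (x / t))"
        using der'[OF \<xi>] by blast
      have sp: "U (x / t) - x / t = \<sigma> * a K (P (x / t))" using speed[OF \<xi>'] agree \<xi>' by simp
      show ?thesis
        unfolding isothermal_euler_iff[OF P' open_greaterThanLessThan \<xi> X \<open>t > 0\<close>] sp
        using pos \<sigma> by (auto simp: field_simps power2_eq_square)
    qed
    moreover have "\<exists>P' U'. (P has_real_derivative P') (at \<xi>) \<and>
        (U has_real_derivative U') (at \<xi>) \<and> (P' \<noteq> 0 \<or> U' \<noteq> 0)" if "\<xi> \<in> {l<..<r}" for \<xi>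
      using der'[OF that] by blast
    moreover have "(P l, U l) = s" "(P r, U r) = s'" using ends agree \<open>l < r\<close> by auto
    ultimately show ?thesis
      unfolding rarefaction_wave_def using \<open>l < r\<close> cont admP by auto
  qed
  then show "\<exists>P0 U0. \<forall>P U. (\<forall>\<xi>\<in>{l..r}. P \<xi> = P0 \<xi> \<and> U \<xi> = U0 \<xi>) \<longrightarrow>
      rarefaction_wave v pmin pt K P U l r s s'" by blast
qed

text \<open>Here \<open>s\<close> is the state ahead of the wave and \<open>(p, u)\<close> the one behind it.\<close>

lemma shock_exists:
  assumes s: "fst s \<in> pdom K" and p: "fst s < p" and \<sigma>: "\<sigma> = 1 \<or> \<sigma> = -1"
    and u: "u = snd s - \<sigma> * wave_fun v a K p s"
  shows "\<exists>W. \<sigma> * (u - W) > 0 \<and>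
    (if \<sigma> = 1 then jump_conditions v g W K s K (p, u) else jump_conditions v g W K (p, u) K s)"
proof -
  obtain p1 u1 where s1: "s = (p1, u1)" by (cases s)
  have p1: "p1 \<in> pdom K" "p1 < p" using assms by (auto simp: s1)
  have p': "p \<in> pdom K" using p1 dom_upward by auto
  \<comment> \<open>The positive solution of the momentum balance
    \<open>p - p1 = m\<^sup>2 * (v K p1 - v K p)\<close>.\<close>
  define m where "m = sqrt ((p - p1) / (v K p1 - v K p))"
  have drop: "v K p1 - v K p > 0" using volume_decreasing[OF p1] by simp
  have m: "m > 0" "m\<^sup>2 * (v K p1 - v K p) = p - p1"
    using drop p1 by (auto simp: m_def)
  have "- (p - p1) * (v K p - v K p1) = (m * (v K p1 - v K p))\<^sup>2"
    unfolding m(2)[symmetric] by (simp add: power2_eq_square algebra_simps)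
  then have "wave_fun v a K p s = m * (v K p1 - v K p)"
    using m(1) drop p1 by (simp add: wave_fun_def s1 real_sqrt_abs)
  then have u': "u = u1 - \<sigma> * (m * (v K p1 - v K p))" using u by (simp add: s1)
  have ent: "m * (g K p - g K p1 - (p - p1) * (v K p1 + v K p) / 2) \<le> 0"
    using gibbs_trapezoid[OF p1] m(1) by (simp add: mult_le_0_iff)
  \<comment> \<open>Chosen so that the state ahead satisfies
    \<open>u1 - W = \<sigma> * m * v K p1\<close>.\<close>
  define W where "W = u1 - \<sigma> * m * v K p1"
  have "\<sigma> * (u - W) = (\<sigma> * \<sigma>) * (m * v K p)"
    by (simp add: u' W_def algebra_simps)
  then have "\<sigma> * (u - W) > 0" using \<sigma> m(1) v_pos[OF p'] by auto
  moreover have "if \<sigma> = 1 then jump_conditions v g W K s K (p, u) else jump_conditions v g W K (p, u) K s"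
  proof (cases "\<sigma> = 1")
    case True
    have "jump_conditions v g W K s K (p, u)"
      unfolding s1 jump_conditions_iff[OF p1(1) p']
      using True m ent by (intro exI[of _ m]) (simp add: W_def u' algebra_simps)
    with True show ?thesis by simp
  next
    case False
    \<comment> \<open>Now the state behind is on the left and the relative flow is reversed, hence
      the witness \<open>-m\<close>.\<close>
    have "jump_conditions v g W K (p, u) K s"
      unfolding s1 jump_conditions_iff[OF p' p1(1)]
      using False \<sigma> m ent by (intro exI[of _ "-m"]) (auto simp: W_def u' algebra_simps add_divide_distrib diff_divide_distrib)
    with False show ?thesis by simp
  qed
  ultimately show ?thesis by blast
qed

text \<open>A shock raises the pressure, a fan lowers it, and a shock of zero strength keeps it. The
  strict inequalities leave room for a phase boundary of speed \<open>u\<close> next to the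
  wave.\<close>

lemma classical_wave_exists:
  assumes s: "fst s \<in> pdom K" and p: "p \<in> pdom K" and \<sigma>: "\<sigma> = 1 \<or> \<sigma> = -1"
    and adm: "{p..fst s} \<subseteq> admissible_pressures pmin pt K"
    and u: "u = snd s - \<sigma> * wave_fun v a K p s"
  shows "\<exists>l r P0 U0. l \<le> r \<and> \<sigma> * (u - l) > 0 \<and> \<sigma> * (u - r) > 0 \<and>
    (\<forall>P U. (\<forall>\<xi>\<in>{l..r}. P \<xi> = P0 \<xi> \<and> U \<xi> = U0 \<xi>) \<longrightarrow>
      (if \<sigma> = 1 then classical_wave v g pmin pt K P U l r s (p, u)
       else classical_wave v g pmin pt K P U l r (p, u) s))"
proof -
  consider "fst s < p" | "fst s = p" | "p < fst s" by linarith
  then show ?thesis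
  proof cases
    case 1
    obtain W where "\<sigma> * (u - W) > 0"
      "if \<sigma> = 1 then jump_conditions v g W K s K (p, u) else jump_conditions v g W K (p, u) K s"
      using shock_exists[OF s 1 \<sigma> u] by blast
    then show ?thesis
      by (intro exI[of _ W]) (auto simp: classical_wave_def split: if_splits)
  next
    case 2
    then have "s = (p, u)" using u by (cases s) (auto simp: wave_fun_def)
    \<comment> \<open>A zero-strength shock may have any speed on the correct side of
      \<open>u\<close>; here it is \<open>u - \<sigma>\<close>.\<close>
    then show ?thesis using \<sigma>
      by (intro exI[of _ "u - \<sigma>"]) (auto simp: classical_wave_def jump_conditions_def)
  next
    case 3
    define s1 s2 where "s1 = (if \<sigma> = 1 then s else (p, u))" and "s2 = (if \<sigma> = 1 then (p, u) else s)"
    define l r where "l = snd s1 - \<sigma> * a K (fst s1)" and "r = snd s2 - \<sigma> * a K (fst s2)"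
    have u': "u = snd s + \<sigma> * integral {p..fst s} (\<lambda>\<zeta>. v K \<zeta> / a K \<zeta>)"
      using u 3 by (simp add: wave_fun_def)
    have cases: "\<sigma> = 1 \<and> s1 = (fst s, snd s) \<and> s2 = (p, u) \<or>
        \<sigma> = -1 \<and> s1 = (p, u) \<and> s2 = (fst s, snd s)"
      using \<sigma> by (auto simp: s1_def s2_def)
    note rare = rarefaction_exists[OF p 3 adm u' cases, folded l_def r_def]
    obtain P0 U0 where "\<forall>P U. (\<forall>\<xi>\<in>{l..r}. P \<xi> = P0 \<xi> \<and> U \<xi> = U0 \<xi>) \<longrightarrow>
      rarefaction_wave v pmin pt K P U l r s1 s2" using rare(2) by blast
    moreover have "\<sigma> * (u - l) > 0" "\<sigma> * (u - r) > 0"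
      using rare(1) cases a_pos[OF p] by (auto simp: l_def r_def)
    ultimately show ?thesis using rare(1)
      by (intro exI[of _ l] exI[of _ r] exI[of _ P0] exI[of _ U0])
        (auto simp: classical_wave_def s1_def s2_def split: if_splits)
  qed
qed

section \<open>The Riemann problem without phase transition\<close>

lemma wave_fun_self: "wave_fun v a K (fst s) s = 0"
  by (simp add: wave_fun_def)

text \<open>A left-facing wave would begin at \<open>l \<le> snd s - a < snd s\<close>, against
  \<open>snd s < l\<close>. For equal states the wave function vanishes.\<close>

lemma right_wave:
  assumes "classical_wave v g pmin pt K P U l r s s'" and dom: "fst s \<in> pdom K" "fst s' \<in> pdom K"
    and "snd s < l"
  shows "snd s = snd s' + wave_fun v a K (fst s) s'"
  using classical_wave_cases[OF assms(1) dom] assms(4) a_pos[OF dom(1)]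
  by (auto simp: oriented_wave_def wave_fun_self)

lemma left_wave:
  assumes "classical_wave v g pmin pt K P U l r s s'" and dom: "fst s \<in> pdom K" "fst s' \<in> pdom K"
    and "r < snd s'"
  shows "snd s' = snd s - wave_fun v a K (fst s') s"
  using classical_wave_cases[OF assms(1) dom] assms(4) a_pos[OF dom(2)]
  by (auto simp: oriented_wave_def wave_fun_self)

text \<open>
  By the Lax conditions, two waves of the same family inside one phase would collide, since the first
  is at least and the second at most as fast as the sound wave in the state between them; so one of
  two consecutive waves on the same side of the phase boundary is trivial.
\<close>

lemma two_right_waves:
  assumes waves: "classical_wave v g pmin pt K P U l r s s'" "classical_wave v g pmin pt K P U l' r' s' s''"
    and dom: "fst s \<in> pdom K" "fst s' \<in> pdom K" "fst s'' \<in> pdom K"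
    and ord: "snd s < l" "l \<le> r" "r < l'"
  shows "snd s = snd s'' + wave_fun v a K (fst s) s''"
proof (cases "s = s'")
  case True
  then show ?thesis using right_wave[OF waves(2) dom(2,3)] ord by simp
next
  case False
  \<comment> \<open>The first wave is right-facing, so \<open>snd s' + a \<le> r\<close>. A
    nontrivial second wave of either orientation would have \<open>l' \<le> snd s' + a\<close>,
    against \<open>r < l'\<close>.\<close>
  then have "s' = s''"
    using classical_wave_cases[OF waves(1) dom(1,2)] classical_wave_cases[OF waves(2) dom(2,3)]
      ord a_pos[OF dom(1)] a_pos[OF dom(2)]
    by (auto simp: oriented_wave_def)
  then show ?thesis using right_wave[OF waves(1) dom(1,2)] ord by simp
qed

lemma two_left_waves:
  assumes waves: "classical_wave v g pmin pt K P U l r s s'" "classical_wave v g pmin pt K P U l' r' s' s''"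
    and dom: "fst s \<in> pdom K" "fst s' \<in> pdom K" "fst s'' \<in> pdom K"
    and ord: "r < l'" "l' \<le> r'" "r' < snd s''"
  shows "snd s'' = snd s - wave_fun v a K (fst s'') s"
proof (cases "s' = s''")
  case True
  then show ?thesis using left_wave[OF waves(1) dom(1,2)] ord by simp
next
  case False
  then have "s = s'"
    using classical_wave_cases[OF waves(1) dom(1,2)] classical_wave_cases[OF waves(2) dom(2,3)]
      ord a_pos[OF dom(2)] a_pos[OF dom(3)]
    by (auto simp: oriented_wave_def)
  then show ?thesis using left_wave[OF waves(2) dom(2,3)] ord by simp
qed

lemma mass_flux_eq_0_iff:
  "fst s \<in> pdom K \<Longrightarrow> mass_flux v W K s = 0 \<longleftrightarrow> snd s = W"
  using v_pos[of "fst s" K] by (auto simp: mass_flux_def density_def)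

text \<open>With zero mass flux both adjacent velocities equal the speed of the boundary, and the
  momentum balance equates the pressures. The ordering of the waves then selects the orientation on
  each side.\<close>

lemma solution_without_phase_transition_imp:
  assumes sol: "solution_without_phase_transition v g pmin pt WV WL WV' WL'"
  shows "WV' = WL'" "0 < fst WV'" "fst WV' \<le> pt"
    and "snd WV' = snd WV - wave_fun v a Vapor (fst WV') WV"
    and "snd WV' = snd WL + wave_fun v a Liquid (fst WV') WL"
proof -
  obtain j l r S P U where rs: "riemann_solution v g pmin pt WV WL j l r S P U"
    and ends: "S (j - 1) = WV'" "S j = WL'" and flux: "mass_flux v (l j) Vapor (S (j - 1)) = 0"
    using sol by (auto simp: solution_without_phase_transition_def)
  have j: "j \<in> {1, 2, 3}"
    and lr: "l 1 \<le> r 1" "l 2 \<le> r 2" "l 3 \<le> r 3" "r 1 < l 2" "r 2 < l 3"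
    and S: "S 0 = WV" "S 3 = WL"
    and adm: "\<forall>i\<in>{0, 1, 2, 3}. fst (S i) \<in> admissible_pressures pmin pt (phase_of j i)"
    and waves: "\<forall>i\<in>{1, 2, 3} - {j}.
        classical_wave v g pmin pt (phase_of j i) P U (l i) (r i) (S (i - 1)) (S i)"
    and pb: "l j = r j" "jump_conditions v g (l j) Vapor (S (j - 1)) Liquid (S j)"
    using rs unfolding riemann_solution_def by blast+
  have dom: "fst (S i) \<in> pdom (phase_of j i)" if "i \<in> {0, 1, 2, 3}" for i
    using adm that admissible_subset_dom by blast
  have admV: "fst WV' \<in> admissible_pressures pmin pt Vapor"
    using bspec[OF adm, of "j - 1"] j ends(1) by (auto simp: phase_of_def)
  then show "0 < fst WV'" "fst WV' \<le> pt" by auto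
  have domL: "fst WL' \<in> pdom Liquid"
    using dom[of j] j ends(2) by (auto simp: phase_of_def)
  have domV: "fst WV' \<in> pdom Vapor" using admV by simp
  have fluxL: "mass_flux v (l j) Liquid WL' = 0" and "fst WL' = fst WV'"
    using pb(2) flux unfolding ends by (simp_all add: jump_conditions_def)
  then have u: "snd WV' = l j" "snd WL' = l j"
    using flux mass_flux_eq_0_iff domV domL unfolding ends by blast+
  with \<open>fst WL' = fst WV'\<close> show eq: "WV' = WL'" by (simp add: prod_eq_iff)
  \<comment> \<open>If the boundary is the first or the last wave, both classical waves lie in one
    phase; on the other side the adjacent state is the initial one, where the wave function
    vanishes.\<close>
  consider "j = 1" | "j = 2" | "j = 3" using j by auto
  then have "snd WV' = snd WV - wave_fun v a Vapor (fst WV') WV \<and>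
    snd WV' = snd WL + wave_fun v a Liquid (fst WV') WL"
  proof cases
    case 1
    have "classical_wave v g pmin pt Liquid P U (l 2) (r 2) WV' (S 2)"
      "classical_wave v g pmin pt Liquid P U (l 3) (r 3) (S 2) WL"
      using bspec[OF waves, of 2] bspec[OF waves, of 3] 1 S ends eq by (auto simp: phase_of_def)
    moreover have "fst (S 2) \<in> pdom Liquid" "fst WL \<in> pdom Liquid"
      using dom[of 2] dom[of 3] 1 S by (auto simp: phase_of_def)
    moreover have "snd WV' < l 2" using u(1) 1 pb(1) lr by simp
    moreover have "WV' = WV" using ends(1) S(1) 1 by simp
    ultimately show ?thesis
      using two_right_waves[of pt Liquid P U "l 2" "r 2" WV' "S 2" "l 3" "r 3" WL] lr domL eq
      by (simp add: wave_fun_self)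
  next
    case 2
    have "classical_wave v g pmin pt Vapor P U (l 1) (r 1) WV WV'"
      "classical_wave v g pmin pt Liquid P U (l 3) (r 3) WV' WL"
      using bspec[OF waves, of 1] bspec[OF waves, of 3] 2 S ends eq by (auto simp: phase_of_def)
    moreover have "fst WV \<in> pdom Vapor" "fst WL \<in> pdom Liquid"
      using dom[of 0] dom[of 3] 2 S by (auto simp: phase_of_def)
    ultimately show ?thesis
      using left_wave[of pt Vapor P U "l 1" "r 1" WV WV'] right_wave[of pt Liquid P U "l 3" "r 3" WV' WL]
        u 2 pb(1) lr domL domV eq by simp
  next
    case 3
    have "classical_wave v g pmin pt Vapor P U (l 1) (r 1) WV (S 1)"
      "classical_wave v g pmin pt Vapor P U (l 2) (r 2) (S 1) WV'"
      using bspec[OF waves, of 1] bspec[OF waves, of 2] 3 S ends eq by (auto simp: phase_of_def)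
    moreover have "fst (S 1) \<in> pdom Vapor" "fst WV \<in> pdom Vapor"
      using dom[of 1] dom[of 0] 3 S by (auto simp: phase_of_def)
    moreover have "r 2 < snd WV'" using u(1) 3 pb(1) lr by simp
    moreover have "WV' = WL" using ends(2) S(2) 3 eq by simp
    ultimately show ?thesis
      using two_left_waves[of pt Vapor P U "l 1" "r 1" WV "S 1" "l 2" "r 2" WV'] lr domV
      by (simp add: wave_fun_self)
  qed
  then show "snd WV' = snd WV - wave_fun v a Vapor (fst WV') WV"
    "snd WV' = snd WL + wave_fun v a Liquid (fst WV') WL" by auto
qed

section \<open>Construction of a solution from a root\<close>

text \<open>The root equation says that the velocities computed from the two initial states agree,
  so both waves can be joined at a phase boundary of speed \<open>u\<close>.\<close>

lemma solution_without_phase_transition_exists: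
  assumes WV: "0 < fst WV" "fst WV \<le> pt" and WL: "pmin \<le> fst WL" and p: "0 < p" "p \<le> pt"
    and root: "riemann_fun v a p WV WL = 0"
  defines "u \<equiv> snd WV - wave_fun v a Vapor p WV"
  shows "solution_without_phase_transition v g pmin pt WV WL (p, u) (p, u)"
proof -
  have pL: "pmin \<le> p" using pmin_nonpos p by simp
  have u': "u = snd WL + wave_fun v a Liquid p WL"
    using root by (simp add: riemann_fun_def u_def)
  obtain l1 r1 P1 U1 where 1: "l1 \<le> r1" "r1 < u"
    "\<forall>P U. (\<forall>\<xi>\<in>{l1..r1}. P \<xi> = P1 \<xi> \<and> U \<xi> = U1 \<xi>) \<longrightarrow>
      classical_wave v g pmin pt Vapor P U l1 r1 WV (p, u)"
  proof -
    have "{p..fst WV} \<subseteq> admissible_pressures pmin pt Vapor" using WV p by auto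
    then show ?thesis
      using classical_wave_exists[of WV Vapor p 1 pt u] WV p that by (simp add: u_def) blast
  qed
  obtain l3 r3 P3 U3 where 3: "l3 \<le> r3" "u < l3"
    "\<forall>P U. (\<forall>\<xi>\<in>{l3..r3}. P \<xi> = P3 \<xi> \<and> U \<xi> = U3 \<xi>) \<longrightarrow>
      classical_wave v g pmin pt Liquid P U l3 r3 (p, u) WL"
  proof -
    have "{p..fst WL} \<subseteq> admissible_pressures pmin pt Liquid" using pL by auto
    then show ?thesis
      using classical_wave_exists[of WL Liquid p "-1" pt u] WL pL that by (simp add: u') blast
  qed
  \<comment> \<open>Glues the two waves to the constant states; \<open>c\<close> selects pressure or
    velocity. The wave sectors are closed because a fan prescribes its values at the edges
    too.\<close>
  define pick :: "(state \<Rightarrow> real) \<Rightarrow> (real \<Rightarrow> real) \<Rightarrow> (real \<Rightarrow> real) \<Rightarrow> real \<Rightarrow> real" where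
    "pick c f1 f3 \<xi> = (if \<xi> < l1 then c WV else if \<xi> \<le> r1 then f1 \<xi> else if \<xi> < l3 then c (p, u)
      else if \<xi> \<le> r3 then f3 \<xi> else c WL)" for c f1 f3 \<xi>
  define P where "P = pick fst P1 P3"
  define U where "U = pick snd U1 U3"
  define S where "S i = (if i = 0 then WV else if i = 3 then WL else (p, u))" for i :: nat
  define l where "l i = (if i = 1 then l1 else if i = 2 then u else l3)" for i :: nat
  define r where "r i = (if i = 1 then r1 else if i = 2 then u else r3)" for i :: nat
  have "classical_wave v g pmin pt Vapor P U l1 r1 WV (p, u)"
    by (rule 1(3)[rule_format]) (auto simp: P_def U_def pick_def)
  moreover have "classical_wave v g pmin pt Liquid P U l3 r3 (p, u) WL"
    by (rule 3(3)[rule_format]) (use 1 3 in \<open>auto simp: P_def U_def pick_def\<close>)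
  moreover have "jump_conditions v g u Vapor (p, u) Liquid (p, u)"
    by (simp add: jump_conditions_def mass_flux_def)
  ultimately have "riemann_solution v g pmin pt WV WL 2 l r S P U"
    unfolding riemann_solution_def using 1(1,2) 3(1,2) WV WL p pL
    by (auto simp: l_def r_def S_def P_def U_def pick_def phase_of_def)
  then show ?thesis
    unfolding solution_without_phase_transition_def
    by (intro exI[of _ "2 :: nat"] exI[of _ l] exI[of _ r] exI[of _ S] exI[of _ P] exI[of _ U])
      (simp add: S_def l_def mass_flux_def)
qed

lemma riemann_fun_increasing:
  assumes "0 < p" "p < q" "0 < fst WV" "pmin \<le> fst WL"
  shows "riemann_fun v a p WV WL < riemann_fun v a q WV WL"
  using wave_fun_increasing[of p Vapor q WV] wave_fun_increasing[of p Liquid q WL] assms pmin_nonpos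
  by (simp add: riemann_fun_def)

end

theorem theorem4p5:
  fixes v a g :: "phase \<Rightarrow> real \<Rightarrow> real"
    and pmin p0 \<tau> \<alpha> \<beta> pt :: real
    and vbar :: "real \<Rightarrow> real"
    and pV uV pL uL ps :: real
  assumes setting: "two_phase_setting v a g pmin p0 \<tau> \<alpha> \<beta>"
    and pt: "max_vapor_pressure v pmin p0 vbar pt" "pt \<le> sigma_max \<alpha> * p0"
    and vapor_data: "0 < pV" "pV \<le> pt"
    and liquid_data: "pmin \<le> pL"
    and root: "riemann_fun v a ps (pV, uV) (pL, uL) = 0" "0 < ps" "ps \<le> pt"
  shows
    "(\<forall>p. 0 < p \<and> p \<le> pt \<and> riemann_fun v a p (pV, uV) (pL, uL) = 0 \<longrightarrow> p = ps) \<and>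
     (\<exists>uVs uLs. solution_without_phase_transition v g pmin pt (pV, uV) (pL, uL) (ps, uVs) (ps, uLs)) \<and>
     (\<forall>pVs uVs pLs uLs.
        solution_without_phase_transition v g pmin pt (pV, uV) (pL, uL) (pVs, uVs) (pLs, uLs) \<longrightarrow>
        pVs = ps \<and> pLs = ps \<and> uVs = uLs \<and>
        uVs = 1 / 2 * (uL + uV)
              + 1 / 2 * (wave_fun v a Liquid ps (pL, uL) - wave_fun v a Vapor ps (pV, uV)))"
proof -
  interpret two_phase_setting v a g pmin p0 \<tau> \<alpha> \<beta> by (rule setting)
  have unique: "p = ps" if "0 < p" "riemann_fun v a p (pV, uV) (pL, uL) = 0" for p
    using riemann_fun_increasing[of p ps "(pV, uV)" "(pL, uL)"]
      riemann_fun_increasing[of ps p "(pV, uV)" "(pL, uL)"] that root vapor_data liquid_data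
    by (cases p ps rule: linorder_cases) auto
  moreover have "\<exists>uVs uLs.
      solution_without_phase_transition v g pmin pt (pV, uV) (pL, uL) (ps, uVs) (ps, uLs)"
    using solution_without_phase_transition_exists[of "(pV, uV)" pt "(pL, uL)" ps]
      root vapor_data liquid_data by auto
  moreover have "pVs = ps \<and> pLs = ps \<and> uVs = uLs \<and>
      uVs = 1 / 2 * (uL + uV)
        + 1 / 2 * (wave_fun v a Liquid ps (pL, uL) - wave_fun v a Vapor ps (pV, uV))"
    if "solution_without_phase_transition v g pmin pt (pV, uV) (pL, uL) (pVs, uVs) (pLs, uLs)"
    for pVs uVs pLs uLs
  proof -
    note sol = solution_without_phase_transition_imp[OF that, simplified]
    \<comment> \<open>The difference of the two velocity formulas in \<open>sol\<close> is the
      equation f = 0.\<close>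
    have "riemann_fun v a pVs (pV, uV) (pL, uL) = 0"
      using sol by (simp add: riemann_fun_def)
    then have "pVs = ps" using unique sol by blast
    \<comment> \<open>The mean of the same two formulas is the expression for the velocity.\<close>
    with sol show ?thesis by (auto simp: field_simps)
  qed
  ultimately show ?thesis by blast
qed

end
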